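(* Let $K$ be an infinite field, $n\ge 2$, and $S=K[x_1,\ldots,x_n]$. If $I\subset S$ is an ideal of Borel type, then $$\mathrm{reg}(I)=\min\{e : I_{\ge e}\ \text{is stable}\}.$$
   Context: $S=K[x_1,\ldots,x_n]$ has the standard grading. A monomial ideal $I\subset S$ is of Borel type if $(I:x_j^\infty)=(I:(x_1,\ldots,x_j)^\infty)$ for all $j=1,\ldots,n$, where $(I:J^\infty)=\bigcup_{k\ge 1}(I:J^k)$. For a monomial $u\ne 1$, $m(u)=\max\{i: x_i\mid u\}$. A monomial ideal $I$ is stable if for every monomial $u\in I$, $u\neq 1$, and every $i<m(u)$ one has $x_iu/x_{m(u)}\in I$. For an integer $e$, $I_{\ge e}$ is the ideal generated by the monomials of degree $\ge e$ in $I$. $\mathrm{reg}(I)$ is the Castelnuovo-Mumford regularity of $I$ as a graded $S$-module, $\mathrm{reg}(I)=\max\{j-i: \mathrm{Tor}_i^S(I,K)_j\ne 0\}$.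
   Formalization: The minimum is taken over integers e ≥ deg(I), the largest degree of a minimal monomial generator, and I ≠ 0 is assumed; as stated it fails for I=(x_1,...,x_n)^2, where I_{≥e}=I is stable for all e ≤ 2 but reg(I)=2, and for I=0 neither side exists. *)

theory Defs
  imports Complex_Main "HOL-Library.Cardinality" "HOL-Library.Poly_Mapping"
begin

section \<open>Polynomial rings and monomial ideals\<close>

text \<open>
  The variables are the elements of a finite linearly ordered type \<open>'n\<close>, listed increasingly as
  $x_1,\ldots,x_n$ with $n$ the cardinality of \<open>'n\<close>. Beware that the library's \<open>\<le>\<close> on
  exponent vectors is a lexicographic order, not divisibility of monomials.
\<close>

type_synonym 'n expo = "'n \<Rightarrow>\<^sub>0 nat"
type_synonym ('n, 'k) mpoly = "'n expo \<Rightarrow>\<^sub>0 'k"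

definition monom :: "'n expo \<Rightarrow> ('n, 'k::field) mpoly"
  where "monom t = Poly_Mapping.single t 1"

definition var :: "'n \<Rightarrow> ('n, 'k::field) mpoly"
  where "var i = monom (Poly_Mapping.single i 1)"

definition expo_deg :: "'n::finite expo \<Rightarrow> nat"
  where "expo_deg t = (\<Sum>i\<in>UNIV. Poly_Mapping.lookup t i)"

definition homogeneous :: "int \<Rightarrow> ('n::finite, 'k::field) mpoly \<Rightarrow> bool"
  where "homogeneous d p \<longleftrightarrow> (\<forall>t\<in>Poly_Mapping.keys p. int (expo_deg t) = d)"

definition ideal_gen :: "'a::comm_ring_1 set \<Rightarrow> 'a set"
  where "ideal_gen A = module.span (*) A"

definition monomial_ideal :: "('n, 'k::field) mpoly set \<Rightarrow> bool"
  where "monomial_ideal I \<longleftrightarrow> (\<exists>A. I = ideal_gen (monom ` A))"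

definition min_gens :: "('n, 'k::field) mpoly set \<Rightarrow> 'n expo set"
  where "min_gens I =
    {t. monom t \<in> I \<and> (\<forall>s. monom s \<in> I \<longrightarrow> (monom s :: ('n, 'k) mpoly) dvd monom t \<longrightarrow> s = t)}"

text \<open>
  $\deg I$, the largest degree of a minimal monomial generator of a monomial ideal $I \neq 0$.
  The truncation at $e$ is generated in the single degree $e$ exactly when $e \ge \deg I$; below that,
  its stability does not bound the regularity: for $I = (x_1,\ldots,x_n)^2$ the truncation at every
  $e \le 2$ is the stable ideal $I$, of regularity 2.
\<close>

definition gen_deg :: "('n::finite, 'k::field) mpoly set \<Rightarrow> nat"
  where "gen_deg I = Max (expo_deg ` min_gens I)"

definition truncation :: "('n::finite, 'k::field) mpoly set \<Rightarrow> int \<Rightarrow> ('n, 'k) mpoly set"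
  where "truncation I e = ideal_gen {monom t | t. monom t \<in> I \<and> e \<le> int (expo_deg t)}"

text \<open>The subtraction below is exact: $x_{m(u)}$ divides $u$.\<close>

definition stable_ideal :: "('n::{finite,linorder}, 'k::field) mpoly set \<Rightarrow> bool"
  where "stable_ideal I \<longleftrightarrow> monomial_ideal I \<and>
    (\<forall>t. monom t \<in> I \<longrightarrow> t \<noteq> 0 \<longrightarrow>
      (\<forall>i < Max (Poly_Mapping.keys t).
        monom (Poly_Mapping.single i 1 + t
          - Poly_Mapping.single (Max (Poly_Mapping.keys t)) 1) \<in> I))"


section \<open>Ideals of Borel type\<close>

primrec ideal_power :: "'a::comm_ring_1 set \<Rightarrow> nat \<Rightarrow> 'a set"
  where
    "ideal_power J 0 = UNIV"
  | "ideal_power J (Suc k) = ideal_gen {a * b | a b. a \<in> J \<and> b \<in> ideal_power J k}"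

definition colon :: "'a::comm_ring_1 set \<Rightarrow> 'a set \<Rightarrow> 'a set"
  where "colon I J = {f. \<forall>g\<in>J. f * g \<in> I}"

definition saturation :: "'a::comm_ring_1 set \<Rightarrow> 'a set \<Rightarrow> 'a set"
  where "saturation I J = (\<Union>k\<in>{1..}. colon I (ideal_power J k))"

definition borel_type :: "('n::{finite,linorder}, 'k::field) mpoly set \<Rightarrow> bool"
  where "borel_type I \<longleftrightarrow> monomial_ideal I \<and>
    (\<forall>j. saturation I (ideal_gen {var j}) = saturation I (ideal_gen (var ` {..j})))"


section \<open>Tor and Castelnuovo-Mumford regularity\<close>

text \<open>
  A complex of graded free modules
  $\cdots \to G_2 \to G_1 \to G_0$ with
  $G_i = \bigoplus_{k < \mathrm{rank}\,i} S(-\mathrm{twist}\,i\,k)$.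
  The entry in row \<open>l\<close> and column \<open>k\<close> of the matrix of $G_{i+1} \to G_i$ is \<open>dmat i l k\<close>.
  Elements of $G_i$ are coordinate vectors, extended by zero beyond the rank.
\<close>

record 'a free_complex =
  rank :: "nat \<Rightarrow> nat"
  twist :: "nat \<Rightarrow> nat \<Rightarrow> int"
  dmat :: "nat \<Rightarrow> nat \<Rightarrow> nat \<Rightarrow> 'a"

text \<open>
  For an ideal $I$, the module $I \otimes_S G_i$ is the direct sum of \<open>rank i\<close> copies of $I$,
  that is, the vectors of $G_i$ with all coordinates in $I$; the matrices of $G$ act on these.
  The case $I = S$ gives $G$ itself.
\<close>

definition chains ::
    "('n, 'k::field) mpoly set \<Rightarrow> ('n, 'k) mpoly free_complex \<Rightarrow> nat \<Rightarrow> (nat \<Rightarrow> ('n, 'k) mpoly) set"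
  where "chains I G i = {v. (\<forall>k < rank G i. v k \<in> I) \<and> (\<forall>k \<ge> rank G i. v k = 0)}"

definition graded_chains ::
    "('n::finite, 'k::field) mpoly set \<Rightarrow> ('n, 'k) mpoly free_complex \<Rightarrow> nat \<Rightarrow> int
      \<Rightarrow> (nat \<Rightarrow> ('n, 'k) mpoly) set"
  where "graded_chains I G i j =
    {v \<in> chains I G i. \<forall>k < rank G i. homogeneous (j - twist G i k) (v k)}"

primrec boundary ::
    "('n, 'k::field) mpoly free_complex \<Rightarrow> nat \<Rightarrow> (nat \<Rightarrow> ('n, 'k) mpoly) \<Rightarrow> (nat \<Rightarrow> ('n, 'k) mpoly)"
  where
    "boundary G 0 v = (\<lambda>_. 0)"
  | "boundary G (Suc i) v =
      (\<lambda>l. if l < rank G i then \<Sum>k < rank G (Suc i). dmat G i l k * v k else 0)"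

text \<open>
  A graded map $G_0 \to K = S/(x_1,\ldots,x_n)$ is given by the images \<open>c k\<close> of the basis vectors;
  as $K$ lives in degree 0, only basis vectors of degree 0 have a nonzero image. The residue
  class of a polynomial in $K$ is its constant term.
\<close>

definition augmentation ::
    "('n, 'k::field) mpoly free_complex \<Rightarrow> (nat \<Rightarrow> 'k) \<Rightarrow> (nat \<Rightarrow> ('n, 'k) mpoly) \<Rightarrow> 'k"
  where "augmentation G c v = (\<Sum>k < rank G 0. c k * Poly_Mapping.lookup (v k) 0)"

definition resolves_field :: "('n::finite, 'k::field) mpoly free_complex \<Rightarrow> bool"
  where "resolves_field G \<longleftrightarrow>
    (\<forall>i. \<forall>l < rank G i. \<forall>k < rank G (Suc i).
        homogeneous (twist G (Suc i) k - twist G i l) (dmat G i l k)) \<and>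
    (\<exists>c. (\<forall>k < rank G 0. c k \<noteq> 0 \<longrightarrow> twist G 0 k = 0) \<and>
         augmentation G c ` chains UNIV G 0 = UNIV \<and>
         {v \<in> chains UNIV G 0. augmentation G c v = 0}
           = boundary G (Suc 0) ` chains UNIV G (Suc 0)) \<and>
    (\<forall>i. {v \<in> chains UNIV G (Suc i). boundary G (Suc i) v = (\<lambda>_. 0)}
           = boundary G (Suc (Suc i)) ` chains UNIV G (Suc (Suc i)))"

text \<open>
  $\mathrm{Tor}_i^S(I,K)$ is the $i$-th left derived functor of $I \otimes_S -$ at $K$: the homology
  of $I \otimes_S G$ for a graded free resolution $G$ of $K$. Up to isomorphism it does
  not depend on $G$, and finite ranks suffice since $S$ is noetherian.
\<close>

definition field_resolution :: "('n::finite, 'k::field) mpoly free_complex"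
  where "field_resolution = (SOME G. resolves_field G)"

definition tor_cycles ::
    "('n::finite, 'k::field) mpoly set \<Rightarrow> nat \<Rightarrow> int \<Rightarrow> (nat \<Rightarrow> ('n, 'k) mpoly) set"
  where "tor_cycles I i j =
    {v \<in> graded_chains I field_resolution i j. boundary field_resolution i v = (\<lambda>_. 0)}"

definition tor_boundaries ::
    "('n::finite, 'k::field) mpoly set \<Rightarrow> nat \<Rightarrow> int \<Rightarrow> (nat \<Rightarrow> ('n, 'k) mpoly) set"
  where "tor_boundaries I i j =
    boundary field_resolution (Suc i) ` graded_chains I field_resolution (Suc i) j"

text \<open>$\mathrm{Tor}_i^S(I,K)_j$ is the quotient of the cycles by the boundaries.\<close>

definition tor_nonzero :: "('n::finite, 'k::field) mpoly set \<Rightarrow> nat \<Rightarrow> int \<Rightarrow> bool"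
  where "tor_nonzero I i j \<longleftrightarrow> \<not> tor_cycles I i j \<subseteq> tor_boundaries I i j"

definition regularity :: "('n::finite, 'k::field) mpoly set \<Rightarrow> int"
  where "regularity I = (GREATEST r. \<exists>i j. tor_nonzero I i j \<and> r = j - int i)"

end

theory Submission
  imports Defs
begin

text \<open>
  Both sides are compared with the least \<open>e\<close> such that, for all monomials \<open>u\<close> of degree at least \<open>e\<close>
  and all \<open>m\<close> with $u \in K[x_1,\ldots,x_m]$, $x_m u \in I$ implies $u \in I$. For $e \ge \deg I$ this
  condition is equivalent to stability of $I_{\ge e}$, and for $I$ of Borel type it holds for
  large $e$.

  In each multidegree $a$ the Koszul complex is the chain complex of the full simplex on the support of
  $a$. Coning with the largest vertex contracts it, and under the condition the cone operator
  preserves coefficients in $I$ from degree $e + 1$ on, so $\mathrm{Tor}_i(I,K)_j = 0$ for $j - i > e$.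
  If $e$ is least and positive, there are $u \notin I$ of degree $e - 1$ and $m$ with $u (x_1,\ldots,x_m) \subseteq I$
  and $u \in K[x_1,\ldots,x_m]$; the boundary of $u\, e_1 \wedge \cdots \wedge e_m$ is then a nonzero class in
  $\mathrm{Tor}_{m-1}(I,K)_{m-1+e}$.
\<close>

text \<open>The colon condition is dictated by the cone. Coning with the largest \<open>m\<close> in
  the support of a multidegree moves a coefficient from \<open>F - {m}\<close> to \<open>F\<close>,
  hence from a monomial \<open>s x_m\<close> to \<open>s\<close>, where every variable of
  \<open>s\<close> is at most \<open>x_m\<close>; staying inside \<open>I\<close> is closure under
  just these divisions. On a face with \<open>i + 1\<close> vertices in degree \<open>j\<close> the
  monomial \<open>s\<close> has degree \<open>j - i - 1\<close>, whence the shift by one between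
  \<open>e\<close> and the vanishing range. For \<open>I = S\<close> the same cone shows that the
  Koszul complex resolves \<open>K\<close>. The obstacle is that Tor is taken with an arbitrarily
  chosen resolution, so a comparison of graded resolutions has to carry exactness to and from the
  Koszul complex. That Borel type forces the condition in large degrees rests on the bound
  \<open>n deg I\<close>: beyond it some exponent of the monomial exceeds \<open>deg I\<close>, and
  further powers of that variable are invisible to the minimal generators.\<close>

abbreviation lookup :: "('a \<Rightarrow>\<^sub>0 'b::zero) \<Rightarrow> 'a \<Rightarrow> 'b"
  where "lookup \<equiv> Poly_Mapping.lookup"

abbreviation keys :: "('a \<Rightarrow>\<^sub>0 'b::zero) \<Rightarrow> 'a set"
  where "keys \<equiv> Poly_Mapping.keys"

abbreviation unit_expo :: "'n \<Rightarrow> 'n expo"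
  where "unit_expo i \<equiv> Poly_Mapping.single i 1"

section \<open>Exponents and homogeneous polynomials\<close>

lemma expo_deg_zero [simp]: "expo_deg 0 = 0"
  by (simp add: expo_deg_def)

lemma expo_deg_add [simp]: "expo_deg (s + t) = expo_deg s + expo_deg t"
  by (simp add: expo_deg_def lookup_add sum.distrib)

lemma expo_deg_unit [simp]: "expo_deg (Poly_Mapping.single i c) = c"
  by (simp add: expo_deg_def lookup_single when_def)

lemma expo_deg_eq_0_iff [simp]: "expo_deg t = 0 \<longleftrightarrow> t = 0"
  by (auto simp: expo_deg_def intro!: poly_mapping_eqI)

lemma unit_expo_cancel:
  fixes t :: "'n expo"
  assumes "i \<in> keys t"
  shows "t - unit_expo i + unit_expo i = t"
  using assms by (intro poly_mapping_eqI)
    (auto simp: lookup_add lookup_minus lookup_single when_def in_keys_iff)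

lemma keys_add_expo: "keys (s + t) = keys s \<union> keys (t :: 'n expo)"
  by (auto simp: in_keys_iff lookup_add)

text \<open>Supersets of the supports are allowed so that the one index to be picked out can be put
  into the range even when its coefficient vanishes.\<close>

lemma lookup_times:
  fixes p q :: "'a::monoid_add \<Rightarrow>\<^sub>0 'b::semiring_0"
  assumes "finite A" "keys p \<subseteq> A" "finite B" "keys q \<subseteq> B"
  shows "lookup (p * q) k = (\<Sum>l\<in>A. \<Sum>m\<in>B. if k = l + m then lookup p l * lookup q m else 0)"
proof -
  have inner: "Sum_any (\<lambda>m. lookup q m when k = l + m) = (\<Sum>m\<in>B. lookup q m when k = l + m)" for l
    by (rule Sum_any.expand_superset) (use assms in \<open>auto simp: in_keys_iff\<close>)
  have "lookup (p * q) k = Sum_any (\<lambda>l. lookup p l * (\<Sum>m\<in>B. lookup q m when k = l + m))"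
    by (simp add: lookup_mult inner)
  also have "\<dots> = (\<Sum>l\<in>A. lookup p l * (\<Sum>m\<in>B. lookup q m when k = l + m))"
    using assms by (intro Sum_any.expand_superset) (auto simp: subset_iff in_keys_iff dest!: mult_not_zero)
  also have "\<dots> = (\<Sum>l\<in>A. \<Sum>m\<in>B. if k = l + m then lookup p l * lookup q m else 0)"
    by (simp add: sum_distrib_left when_def if_distrib cong: if_cong)
  finally show ?thesis .
qed

lemma lookup_single_times:
  fixes p :: "('n, 'k::field) mpoly"
  shows "lookup (Poly_Mapping.single (unit_expo i) c * p) t
    = (if i \<in> keys t then c * lookup p (t - unit_expo i) else 0)"
proof -
  have "lookup (Poly_Mapping.single (unit_expo i) c * p) t
    = (\<Sum>l\<in>{unit_expo i}. \<Sum>m\<in>insert (t - unit_expo i) (keys p).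
        if t = l + m then lookup (Poly_Mapping.single (unit_expo i) c) l * lookup p m else 0)"
    by (rule lookup_times) auto
  also have "\<dots> = (\<Sum>m\<in>insert (t - unit_expo i) (keys p).
        if m = t - unit_expo i then (if i \<in> keys t then c * lookup p m else 0) else 0)"
  proof (simp only: sum.insert finite.emptyI empty_iff sum.empty add_0_right simp_thms if_False,
      rule sum.cong, simp)
    fix m
    have "t = unit_expo i + m \<longleftrightarrow> m = t - unit_expo i \<and> i \<in> keys t"
      using unit_expo_cancel[of i t] by (auto simp: keys_add_expo add.commute)
    then show "(if t = unit_expo i + m
        then lookup (Poly_Mapping.single (unit_expo i) c) (unit_expo i) * lookup p m else 0)
      = (if m = t - unit_expo i then (if i \<in> keys t then c * lookup p m else 0) else 0)"
      by auto
  qed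
  also have "\<dots> = (if i \<in> keys t then c * lookup p (t - unit_expo i) else 0)"
    by (subst sum.delta) auto
  finally show ?thesis .
qed

text \<open>Exponents add up to 0 only if both are 0, so taking the constant term is multiplicative;
  this makes the augmentation compatible with linear combinations.\<close>

lemma lookup_times_zero:
  fixes p q :: "('n, 'k::field) mpoly"
  shows "lookup (p * q) 0 = lookup p 0 * lookup q 0"
proof -
  have zero: "(0 = l + m) \<longleftrightarrow> (l = 0 \<and> m = 0)" for l m :: "'n expo"
    by (metis add.right_neutral keys_add_expo keys_eq_empty keys_zero sup_eq_bot_iff)
  have "lookup (p * q) 0
    = (\<Sum>l\<in>insert 0 (keys p). \<Sum>m\<in>insert 0 (keys q). if 0 = l + m then lookup p l * lookup q m else 0)"
    by (rule lookup_times) auto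
  also have "\<dots> = (\<Sum>l\<in>insert 0 (keys p). if l = 0 then
       (\<Sum>m\<in>insert 0 (keys q). if m = 0 then lookup p l * lookup q m else 0) else 0)"
    by (simp only: zero) (rule sum.cong, simp_all)
  also have "\<dots> = lookup p 0 * lookup q 0"
    by (simp only: sum.delta finite_insert finite_keys) simp
  finally show ?thesis .
qed

lemma keys_monom [simp]: "keys (monom t :: ('n, 'k::field) mpoly) = {t}"
  by (simp add: monom_def)

lemma monom_times: "monom s * monom t = (monom (s + t) :: ('n, 'k::field) mpoly)"
  by (simp add: monom_def mult_single)

lemma poly_mapping_sum_singles:
  fixes p :: "'a \<Rightarrow>\<^sub>0 'b::comm_monoid_add"
  shows "p = (\<Sum>t\<in>keys p. Poly_Mapping.single t (lookup p t))"
  by (rule poly_mapping_eqI) (simp add: lookup_sum lookup_single when_def in_keys_iff)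

lemma homogeneous_zero [simp]: "homogeneous d 0"
  by (simp add: homogeneous_def)

lemma homogeneous_add: "homogeneous d p \<Longrightarrow> homogeneous d q \<Longrightarrow> homogeneous d (p + q)"
  using keys_add[of p q] by (auto simp: homogeneous_def)

lemma homogeneous_uminus: "homogeneous d p \<Longrightarrow> homogeneous d (- p)"
  by (auto simp: homogeneous_def in_keys_iff)

lemma homogeneous_diff: "homogeneous d p \<Longrightarrow> homogeneous d q \<Longrightarrow> homogeneous d (p - q)"
  using homogeneous_add[of d p "- q"] homogeneous_uminus[of d q] by simp

lemma homogeneous_sum: "(\<And>x. x \<in> A \<Longrightarrow> homogeneous d (f x)) \<Longrightarrow> homogeneous d (sum f A)"
  by (induction A rule: infinite_finite_induct) (auto intro: homogeneous_add)

lemma homogeneous_mult: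
  assumes "homogeneous c p" "homogeneous d q"
  shows "homogeneous (c + d) (p * q)"
  using keys_mult[of p q] assms by (fastforce simp: homogeneous_def)

lemma homogeneous_single: "int (expo_deg t) = d \<Longrightarrow> homogeneous d (Poly_Mapping.single t c)"
  by (auto simp: homogeneous_def)

section \<open>Homogeneous components\<close>

definition hom_component :: "int \<Rightarrow> ('n::finite, 'k::field) mpoly \<Rightarrow> ('n, 'k) mpoly"
  where "hom_component d p = Poly_Mapping.mapp (\<lambda>t c. if int (expo_deg t) = d then c else 0) p"

lemma lookup_hom_component:
  "lookup (hom_component d p) t = (if int (expo_deg t) = d then lookup p t else 0)"
  by (auto simp: hom_component_def lookup_mapp when_def in_keys_iff)

lemma keys_hom_component: "keys (hom_component d p) = {t \<in> keys p. int (expo_deg t) = d}"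
  by (simp add: set_eq_iff in_keys_iff lookup_hom_component)

lemma homogeneous_hom_component: "homogeneous d (hom_component d p)"
  by (auto simp: homogeneous_def keys_hom_component)

lemma hom_component_homogeneous: "homogeneous d p \<Longrightarrow> hom_component d p = p"
  by (rule poly_mapping_eqI) (auto simp: lookup_hom_component homogeneous_def in_keys_iff)

lemma hom_component_sum: "hom_component d (sum f A) = (\<Sum>x\<in>A. hom_component d (f x))"
  by (rule poly_mapping_eqI) (simp add: lookup_hom_component lookup_sum)

lemma hom_component_times:
  assumes "homogeneous c p"
  shows "hom_component d (p * q) = p * hom_component (d - c) q"
proof (rule poly_mapping_eqI)
  fix k
  have l: "lookup (p * q) k = (\<Sum>l\<in>keys p. \<Sum>m\<in>keys q. if k = l + m then lookup p l * lookup q m else 0)"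
    by (rule lookup_times) auto
  have r: "lookup (p * hom_component (d - c) q) k = (\<Sum>l\<in>keys p. \<Sum>m\<in>keys q.
      if k = l + m then lookup p l * lookup (hom_component (d - c) q) m else 0)"
    by (rule lookup_times) (auto simp: keys_hom_component)
  show "lookup (hom_component d (p * q)) k = lookup (p * hom_component (d - c) q) k"
  proof (cases "int (expo_deg k) = d")
    case True
    then show ?thesis using assms
      by (auto simp: l r lookup_hom_component homogeneous_def intro!: sum.cong)
  next
    case False
    then show ?thesis using assms
      by (auto simp: r lookup_hom_component homogeneous_def intro!: sum.neutral)
  qed
qed


section \<open>Ideals\<close>

lemma module_times: "module ((*) :: 'a::comm_ring_1 \<Rightarrow> 'a \<Rightarrow> 'a)"
  by unfold_locales (simp_all add: algebra_simps)

definition is_ideal :: "'a::comm_ring_1 set \<Rightarrow> bool"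
  where "is_ideal I \<longleftrightarrow> module.subspace (*) I"

lemmas is_ideal_iff = is_ideal_def[unfolded module.subspace_def[OF module_times]]

lemma is_idealD:
  assumes "is_ideal I"
  shows "0 \<in> I" and "x \<in> I \<Longrightarrow> y \<in> I \<Longrightarrow> x + y \<in> I" and "x \<in> I \<Longrightarrow> c * x \<in> I"
    and "x \<in> I \<Longrightarrow> y \<in> I \<Longrightarrow> x - y \<in> I"
proof -
  show "0 \<in> I" and a: "\<And>x y. x \<in> I \<Longrightarrow> y \<in> I \<Longrightarrow> x + y \<in> I" and m: "\<And>x c. x \<in> I \<Longrightarrow> c * x \<in> I"
    using assms by (auto simp: is_ideal_iff)
  show "x \<in> I \<Longrightarrow> y \<in> I \<Longrightarrow> x - y \<in> I"
    using a[of x "- y"] m[of y "- 1"] by simp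
qed

lemma is_ideal_sum: "is_ideal I \<Longrightarrow> (\<And>x. x \<in> A \<Longrightarrow> f x \<in> I) \<Longrightarrow> sum f A \<in> I"
  by (induction A rule: infinite_finite_induct) (auto intro: is_idealD)

lemma is_ideal_UNIV: "is_ideal UNIV"
  by (simp add: is_ideal_iff)

lemma is_ideal_ideal_gen: "is_ideal (ideal_gen A)"
  unfolding is_ideal_def ideal_gen_def by (rule module.subspace_span[OF module_times])

lemma ideal_gen_superset: "A \<subseteq> ideal_gen A"
  unfolding ideal_gen_def by (rule module.span_superset[OF module_times])

lemma ideal_gen_minimal: "A \<subseteq> I \<Longrightarrow> is_ideal I \<Longrightarrow> ideal_gen A \<subseteq> I"
  unfolding ideal_gen_def is_ideal_def by (rule module.span_minimal[OF module_times])

text \<open>The polynomials all of whose terms are multiples of generators form an ideal containing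
  the generators; conversely such a polynomial is the sum of its terms.\<close>

lemma mem_ideal_gen_monoms:
  fixes p :: "('n, 'k::field) mpoly"
  shows "p \<in> ideal_gen (monom ` A) \<longleftrightarrow> (\<forall>t\<in>keys p. \<exists>a\<in>A. \<exists>s. t = s + a)"
proof
  let ?J = "{p :: ('n, 'k) mpoly. \<forall>t\<in>keys p. \<exists>a\<in>A. \<exists>s. t = s + a}"
  have "is_ideal ?J"
    unfolding is_ideal_iff
  proof (intro conjI ballI allI)
    fix p q assume "p \<in> ?J" "q \<in> ?J"
    then show "p + q \<in> ?J" using keys_add[of p q] by blast
  next
    fix c p assume p: "p \<in> ?J"
    have "\<exists>a\<in>A. \<exists>s. t = s + a" if t: "t \<in> keys (c * p)" for t
    proof -
      obtain u v where "t = u + v" "v \<in> keys p" using t keys_mult[of c p] by blast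
      moreover obtain a s where "a \<in> A" "v = s + a" using p \<open>v \<in> keys p\<close> by blast
      ultimately have "t = (u + s) + a" by (simp add: add.assoc)
      then show ?thesis using \<open>a \<in> A\<close> by blast
    qed
    then show "c * p \<in> ?J" by blast
  qed simp
  moreover have "monom ` A \<subseteq> ?J"
  proof -
    have "\<exists>a'\<in>A. \<exists>s. a = s + a'" if "a \<in> A" for a
      using that by (metis add.left_neutral)
    then show ?thesis by (auto simp: monom_def)
  qed
  ultimately show "p \<in> ideal_gen (monom ` A) \<Longrightarrow> \<forall>t\<in>keys p. \<exists>a\<in>A. \<exists>s. t = s + a"
    using ideal_gen_minimal by blast
next
  assume p: "\<forall>t\<in>keys p. \<exists>a\<in>A. \<exists>s. t = s + a"
  have "Poly_Mapping.single t (lookup p t) \<in> ideal_gen (monom ` A)" if "t \<in> keys p" for t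
  proof -
    obtain a s where "a \<in> A" "t = s + a" using bspec[OF p \<open>t \<in> keys p\<close>] by blast
    then have "Poly_Mapping.single t (lookup p t) = Poly_Mapping.single s (lookup p t) * monom a"
      by (simp only: monom_def mult_single mult_1_right)
    moreover have "(monom a :: ('n, 'k) mpoly) \<in> ideal_gen (monom ` A)"
      using ideal_gen_superset \<open>a \<in> A\<close> by blast
    ultimately show ?thesis by (simp only: is_idealD(3)[OF is_ideal_ideal_gen])
  qed
  then show "p \<in> ideal_gen (monom ` A)"
    by (subst poly_mapping_sum_singles) (blast intro: is_ideal_sum[OF is_ideal_ideal_gen])
qed

lemma monom_mem_ideal_gen_monoms:
  "(monom t :: ('n, 'k::field) mpoly) \<in> ideal_gen (monom ` A) \<longleftrightarrow> (\<exists>a\<in>A. \<exists>s. t = s + a)"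
  by (simp add: mem_ideal_gen_monoms)

lemma monomial_ideal_is_ideal: "monomial_ideal I \<Longrightarrow> is_ideal I"
  by (auto simp: monomial_ideal_def is_ideal_ideal_gen)

text \<open>Reduces membership of polynomials to exponents; every later condition on
  \<open>I\<close> speaks of monomials only.\<close>

lemma mem_monomial_ideal_iff:
  assumes "monomial_ideal I"
  shows "p \<in> I \<longleftrightarrow> (\<forall>t\<in>keys p. monom t \<in> I)"
  using assms by (auto simp: monomial_ideal_def mem_ideal_gen_monoms monom_mem_ideal_gen_monoms)

lemma monom_mem_add: "is_ideal I \<Longrightarrow> monom t \<in> I \<Longrightarrow> monom (s + t) \<in> I"
  by (simp add: is_idealD(3) flip: monom_times)


section \<open>Comparison of resolutions\<close>

text \<open>A map of free modules is encoded by its columns, to be combined with the coordinates of a vector.\<close>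

definition lin_comb :: "nat \<Rightarrow> (nat \<Rightarrow> nat \<Rightarrow> 'a::comm_ring_1) \<Rightarrow> (nat \<Rightarrow> 'a) \<Rightarrow> nat \<Rightarrow> 'a"
  where "lin_comb r c v = (\<lambda>l. \<Sum>k<r. v k * c k l)"

lemma lin_comb_assoc: "lin_comb r c (lin_comb r' c' v) = lin_comb r' (\<lambda>k. lin_comb r c (c' k)) v"
proof
  fix l
  have "lin_comb r c (lin_comb r' c' v) l = (\<Sum>k<r. \<Sum>k'<r'. v k' * c' k' k * c k l)"
    by (simp add: lin_comb_def sum_distrib_right)
  also have "\<dots> = (\<Sum>k'<r'. \<Sum>k<r. v k' * c' k' k * c k l)"
    by (rule sum.swap)
  also have "\<dots> = lin_comb r' (\<lambda>k. lin_comb r c (c' k)) v l"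
    by (simp add: lin_comb_def sum_distrib_left mult.assoc)
  finally show "lin_comb r c (lin_comb r' c' v) l = lin_comb r' (\<lambda>k. lin_comb r c (c' k)) v l" .
qed

lemma lin_comb_cong: "(\<And>k. k < r \<Longrightarrow> c k = c' k) \<Longrightarrow> lin_comb r c v = lin_comb r c' v"
  by (simp add: lin_comb_def)

lemma lin_comb_zero_left [simp]: "lin_comb r (\<lambda>k l. 0) v = (\<lambda>l. 0)"
  by (simp add: lin_comb_def)

lemma lin_comb_zero_right [simp]: "lin_comb r c (\<lambda>l. 0) = (\<lambda>l. 0)"
  by (simp add: lin_comb_def)

lemma lin_comb_diff_left:
  "lin_comb r (\<lambda>k l. c k l - c' k l) v = (\<lambda>l. lin_comb r c v l - lin_comb r c' v l)"
  by (simp add: lin_comb_def right_diff_distrib sum_subtractf)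

lemma lin_comb_diff_right:
  "lin_comb r c (\<lambda>l. v l - w l) = (\<lambda>l. lin_comb r c v l - lin_comb r c w l)"
  by (simp add: lin_comb_def left_diff_distrib sum_subtractf)

definition basis_vec :: "nat \<Rightarrow> nat \<Rightarrow> 'a::zero_neq_one"
  where "basis_vec k = (\<lambda>l. if l = k then 1 else 0)"

lemma lin_comb_basis_vec: "k < r \<Longrightarrow> lin_comb r c (basis_vec k) = c k"
proof
  fix l assume "k < r"
  have "lin_comb r c (basis_vec k) l = (\<Sum>k'<r. if k' = k then c k' l else 0)"
    unfolding lin_comb_def basis_vec_def by (rule sum.cong) auto
  then show "lin_comb r c (basis_vec k) l = c k l" using \<open>k < r\<close> by simp
qed

lemma lin_comb_of_basis:
  assumes "\<forall>k\<ge>r. v k = 0"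
  shows "lin_comb r basis_vec v = v"
proof
  fix l
  have "lin_comb r basis_vec v l = (\<Sum>k<r. if k = l then v k else 0)"
    unfolding lin_comb_def basis_vec_def by (rule sum.cong) auto
  then show "lin_comb r basis_vec v l = v l" using assms by simp
qed

text \<open>The image of a basis vector. With this, boundaries, chain maps and homotopies are all
  instances of \<open>lin_comb\<close> and compose by \<open>lin_comb_assoc\<close>.\<close>

definition boundary_column :: "('n, 'k::field) mpoly free_complex \<Rightarrow> nat \<Rightarrow> nat \<Rightarrow> nat \<Rightarrow> ('n, 'k) mpoly"
  where "boundary_column G i k = (\<lambda>l. if l < rank G i then dmat G i l k else 0)"

lemma boundary_Suc_eq: "boundary G (Suc i) v = lin_comb (rank G (Suc i)) (boundary_column G i) v"
  by (auto simp: lin_comb_def boundary_column_def mult.commute intro!: sum.cong)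

declare boundary.simps(2) [simp del]

lemma boundary_lin_comb:
  "boundary G i (lin_comb r c v) = lin_comb r (\<lambda>k. boundary G i (c k)) v"
  by (cases i) (simp_all add: boundary_Suc_eq lin_comb_assoc)

lemma boundary_diff:
  "boundary G i (\<lambda>l. v l - w l) = (\<lambda>l. boundary G i v l - boundary G i w l)"
  by (cases i) (simp_all add: boundary_Suc_eq lin_comb_diff_right)

lemma boundary_beyond_rank: "l \<ge> rank G i \<Longrightarrow> boundary G (Suc i) v l = 0"
  by (simp add: boundary.simps)

lemma augmentation_lin_comb:
  "augmentation G a (lin_comb r c v) = (\<Sum>k<r. lookup (v k) 0 * augmentation G a (c k))"
proof -
  have "augmentation G a (lin_comb r c v)
      = (\<Sum>l<rank G 0. \<Sum>k<r. lookup (v k) 0 * (a l * lookup (c k l) 0))"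
    by (simp add: augmentation_def lin_comb_def lookup_sum lookup_times_zero sum_distrib_left mult_ac)
  also have "\<dots> = (\<Sum>k<r. lookup (v k) 0 * augmentation G a (c k))"
    unfolding augmentation_def sum_distrib_left by (rule sum.swap)
  finally show ?thesis .
qed

lemma augmentation_diff:
  "augmentation G a (\<lambda>l. v l - w l) = augmentation G a v - augmentation G a w"
  by (simp add: augmentation_def lookup_minus right_diff_distrib sum_subtractf)

lemma graded_chainsI:
  assumes "\<And>k. k < rank G i \<Longrightarrow> v k \<in> I" "\<And>k. k \<ge> rank G i \<Longrightarrow> v k = 0"
    "\<And>k. k < rank G i \<Longrightarrow> homogeneous (j - twist G i k) (v k)"
  shows "v \<in> graded_chains I G i j"
  using assms by (simp add: graded_chains_def chains_def)

lemma graded_chainsD: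
  assumes "v \<in> graded_chains I G i j"
  shows "k < rank G i \<Longrightarrow> v k \<in> I" and "k \<ge> rank G i \<Longrightarrow> v k = 0"
    and "k < rank G i \<Longrightarrow> homogeneous (j - twist G i k) (v k)" and "v \<in> chains UNIV G i"
  using assms by (simp_all add: graded_chains_def chains_def)

lemma graded_chains_diff:
  assumes "is_ideal I" "v \<in> graded_chains I G i j" "w \<in> graded_chains I G i j"
  shows "(\<lambda>l. v l - w l) \<in> graded_chains I G i j"
  using assms by (auto simp: graded_chains_def chains_def intro: is_idealD(4) homogeneous_diff)

text \<open>A graded map with entries in \<open>S\<close> acts on \<open>I\<close>-valued vectors as
  well, because \<open>I\<close> absorbs the entries: this is the functor that tensors with
  \<open>I\<close>.\<close>

lemma graded_chains_lin_comb:
  assumes I: "is_ideal I"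
    and c: "\<And>k. k < rank G i \<Longrightarrow> c k \<in> graded_chains UNIV H i' (twist G i k)"
    and v: "v \<in> graded_chains I G i j"
  shows "lin_comb (rank G i) c v \<in> graded_chains I H i' j"
proof (rule graded_chainsI)
  fix l
  show "lin_comb (rank G i) c v l \<in> I"
    unfolding lin_comb_def
  proof (rule is_ideal_sum[OF I])
    fix k assume "k \<in> {..<rank G i}"
    then show "v k * c k l \<in> I"
      using is_idealD(3)[OF I graded_chainsD(1)[OF v], of k "c k l"] by (simp add: mult.commute)
  qed
  show "lin_comb (rank G i) c v l = 0" if "l \<ge> rank H i'"
    unfolding lin_comb_def using graded_chainsD(2)[OF c that] by simp
  show "homogeneous (j - twist H i' l) (lin_comb (rank G i) c v l)" if "l < rank H i'"
    unfolding lin_comb_def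
  proof (rule homogeneous_sum)
    fix k assume "k \<in> {..<rank G i}"
    then have "homogeneous (j - twist G i k + (twist G i k - twist H i' l)) (v k * c k l)"
      using graded_chainsD(3)[OF v, of k] graded_chainsD(3)[OF c that, of k]
      by (intro homogeneous_mult) simp_all
    then show "homogeneous (j - twist H i' l) (v k * c k l)" by simp
  qed
qed

lemma basis_vec_mem: "k < rank G i \<Longrightarrow> basis_vec k \<in> graded_chains UNIV G i (twist G i k)"
  by (rule graded_chainsI) (auto simp: basis_vec_def homogeneous_def)

section \<open>Graded free resolutions of the residue field\<close>

locale resolution =
  fixes G :: "('n::finite, 'k::field) mpoly free_complex" and aug :: "nat \<Rightarrow> 'k"
  assumes homogeneous_dmat:
      "\<And>i l k. l < rank G i \<Longrightarrow> k < rank G (Suc i)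
        \<Longrightarrow> homogeneous (twist G (Suc i) k - twist G i l) (dmat G i l k)"
    and aug_twist: "\<And>k. k < rank G 0 \<Longrightarrow> aug k \<noteq> 0 \<Longrightarrow> twist G 0 k = 0"
    and aug_surj: "augmentation G aug ` chains UNIV G 0 = UNIV"
    and exact_0: "{v \<in> chains UNIV G 0. augmentation G aug v = 0}
        = boundary G (Suc 0) ` chains UNIV G (Suc 0)"
    and exact_Suc: "\<And>i. {v \<in> chains UNIV G (Suc i). boundary G (Suc i) v = (\<lambda>_. 0)}
        = boundary G (Suc (Suc i)) ` chains UNIV G (Suc (Suc i))"

text \<open>Turns the augmentation, existentially bound in \<open>resolves_field\<close>, into a
  parameter to which lifts can refer.\<close>

lemma resolves_field_iff: "resolves_field G \<longleftrightarrow> (\<exists>c. resolution G c)"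
proof
  assume "resolves_field G"
  then obtain c where "\<forall>k < rank G 0. c k \<noteq> 0 \<longrightarrow> twist G 0 k = 0"
    "augmentation G c ` chains UNIV G 0 = UNIV"
    "{v \<in> chains UNIV G 0. augmentation G c v = 0} = boundary G (Suc 0) ` chains UNIV G (Suc 0)"
    by (auto simp: resolves_field_def)
  then have "resolution G c"
    using \<open>resolves_field G\<close> by unfold_locales (simp_all add: resolves_field_def)
  then show "\<exists>c. resolution G c" by blast
next
  assume "\<exists>c. resolution G c"
  then obtain c where "resolution G c" by blast
  then interpret resolution G c .
  show "resolves_field G"
    unfolding resolves_field_def
    using homogeneous_dmat aug_twist aug_surj exact_0 exact_Suc by (intro conjI exI[of _ c]) simp_all
qed

context resolution
begin

text \<open>Cycles of the augmented complex: \<open>boundary G 0\<close> is zero, so in position 0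
  the augmentation takes its place and exactness has the same form everywhere.\<close>

definition cycle :: "nat \<Rightarrow> (nat \<Rightarrow> ('n, 'k) mpoly) \<Rightarrow> bool"
  where "cycle i v \<longleftrightarrow> (if i = 0 then augmentation G aug v = 0 else boundary G i v = (\<lambda>_. 0))"

lemma boundary_column_mem:
  "k < rank G (Suc i) \<Longrightarrow> boundary_column G i k \<in> graded_chains UNIV G i (twist G (Suc i) k)"
  by (rule graded_chainsI) (auto simp: boundary_column_def homogeneous_dmat)

lemma boundary_mem_graded:
  assumes "is_ideal I" "v \<in> graded_chains I G (Suc i) j"
  shows "boundary G (Suc i) v \<in> graded_chains I G i j"
  unfolding boundary_Suc_eq
  using assms by (intro graded_chains_lin_comb) (auto intro: boundary_column_mem)

lemma cycle_boundary:
  assumes "v \<in> chains UNIV G (Suc i)"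
  shows "cycle i (boundary G (Suc i) v)"
proof (cases i)
  case 0
  then show ?thesis using exact_0 assms by (auto simp: cycle_def)
next
  case (Suc m)
  then show ?thesis using exact_Suc[of m] assms by (auto simp: cycle_def)
qed

lemma cycle_boundary_column: "k < rank G (Suc i) \<Longrightarrow> cycle i (boundary_column G i k)"
  using cycle_boundary[of "basis_vec k" i] graded_chainsD(4)[OF basis_vec_mem, of k G "Suc i"]
  by (simp add: boundary_Suc_eq lin_comb_basis_vec)

lemma hom_component_boundary:
  assumes "l < rank G i"
  shows "boundary G (Suc i) (\<lambda>k. if k < rank G (Suc i) then hom_component (j - twist G (Suc i) k) (w k) else 0) l
    = hom_component (j - twist G i l) (boundary G (Suc i) w l)"
  using assms
  by (auto simp: boundary.simps hom_component_sum hom_component_times[OF homogeneous_dmat] intro!: sum.cong)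

text \<open>The resolution is only assumed exact on all vectors. Replacing the coordinates of any
  preimage by their components in the degrees prescribed by \<open>j\<close> keeps the boundary,
  since that is already homogeneous.\<close>

lemma graded_exact:
  assumes v: "v \<in> graded_chains UNIV G i j" and "cycle i v"
  shows "\<exists>w \<in> graded_chains UNIV G (Suc i) j. boundary G (Suc i) w = v"
proof -
  have "v \<in> boundary G (Suc i) ` chains UNIV G (Suc i)"
    using graded_chainsD(4)[OF v] assms(2) exact_0 exact_Suc[of "i - 1"]
    by (cases i) (auto simp: cycle_def)
  then obtain w where w: "boundary G (Suc i) w = v" by blast
  define w' where "w' = (\<lambda>k. if k < rank G (Suc i) then hom_component (j - twist G (Suc i) k) (w k) else 0)"
  have "w' \<in> graded_chains UNIV G (Suc i) j"
    by (rule graded_chainsI) (auto simp: w'_def homogeneous_hom_component)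
  moreover have "boundary G (Suc i) w' = v"
  proof
    fix l show "boundary G (Suc i) w' l = v l"
    proof (cases "l < rank G i")
      case True
      then show ?thesis
        using hom_component_boundary[OF True, of j w] graded_chainsD(3)[OF v True]
        by (simp add: w'_def w hom_component_homogeneous)
    next
      case False
      then show ?thesis using graded_chainsD(2)[OF v, of l] by (simp add: boundary_beyond_rank)
    qed
  qed
  ultimately show ?thesis by blast
qed

lemma graded_exact_family:
  assumes "\<And>k. k < r \<Longrightarrow> v k \<in> graded_chains UNIV G i (t k)" "\<And>k. k < r \<Longrightarrow> cycle i (v k)"
  obtains w where "\<And>k. k < r \<Longrightarrow> w k \<in> graded_chains UNIV G (Suc i) (t k)"
    "\<And>k. k < r \<Longrightarrow> boundary G (Suc i) (w k) = v k"
proof -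
  have "\<forall>k. k < r \<longrightarrow> (\<exists>w. w \<in> graded_chains UNIV G (Suc i) (t k) \<and> boundary G (Suc i) w = v k)"
    using graded_exact assms by blast
  then show thesis using that by metis
qed

text \<open>Basis vectors with nonzero twist are mapped to 0, so cutting a preimage down to its
  degree 0 part does not change its image.\<close>

lemma lift_augmentation:
  assumes "c \<noteq> 0 \<Longrightarrow> d = 0"
  shows "\<exists>v \<in> graded_chains UNIV G 0 d. augmentation G aug v = c"
proof (cases "c = 0")
  case True
  have "(\<lambda>_. 0) \<in> graded_chains UNIV G 0 d" by (rule graded_chainsI) auto
  then show ?thesis using True by (intro bexI) (auto simp: augmentation_def)
next
  case False
  obtain w where w: "augmentation G aug w = c" using aug_surj by (metis UNIV_I imageE)
  define v where "v = (\<lambda>k. if k < rank G 0 then hom_component (- twist G 0 k) (w k) else 0)"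
  have "v \<in> graded_chains UNIV G 0 d"
    using assms[OF False] by (intro graded_chainsI) (auto simp: v_def homogeneous_hom_component)
  moreover have "augmentation G aug v = augmentation G aug w"
    unfolding augmentation_def
  proof (rule sum.cong)
    fix k assume "k \<in> {..<rank G 0}"
    then show "aug k * lookup (v k) 0 = aug k * lookup (w k) 0"
      using aug_twist[of k] by (cases "aug k = 0") (simp_all add: v_def lookup_hom_component)
  qed simp
  ultimately show ?thesis using w by blast
qed

end

text \<open>The homological shift \<open>d\<close> is 0 for chain maps and 1 for homotopies; the
  internal degree is preserved in both cases.\<close>

definition graded_map ::
    "('n::finite, 'k::field) mpoly free_complex \<Rightarrow> ('n, 'k) mpoly free_complex \<Rightarrow> nat
      \<Rightarrow> nat \<Rightarrow> (nat \<Rightarrow> nat \<Rightarrow> ('n, 'k) mpoly) \<Rightarrow> bool"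
  where "graded_map G H d i c \<longleftrightarrow> (\<forall>k < rank G i. c k \<in> graded_chains UNIV H (i + d) (twist G i k))"

lemma graded_map_lin_comb:
  assumes "graded_map G H d i c" "is_ideal I" "v \<in> graded_chains I G i j"
  shows "lin_comb (rank G i) c v \<in> graded_chains I H (i + d) j"
  using assms by (intro graded_chains_lin_comb) (auto simp: graded_map_def)

definition chain_map ::
    "('n::finite, 'k::field) mpoly free_complex \<Rightarrow> ('n, 'k) mpoly free_complex
      \<Rightarrow> (nat \<Rightarrow> nat \<Rightarrow> nat \<Rightarrow> ('n, 'k) mpoly) \<Rightarrow> bool"
  where "chain_map G H f \<longleftrightarrow> (\<forall>i. graded_map G H 0 i (f i) \<and>
    (\<forall>k < rank G (Suc i).
      boundary H (Suc i) (f (Suc i) k) = lin_comb (rank G i) (f i) (boundary_column G i k)))"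

lemma chain_map_boundary:
  assumes "chain_map G H f"
  shows "boundary H (Suc i) (lin_comb (rank G (Suc i)) (f (Suc i)) v)
    = lin_comb (rank G i) (f i) (boundary G (Suc i) v)"
  unfolding boundary_lin_comb boundary_Suc_eq[of G] lin_comb_assoc
  using assms by (intro lin_comb_cong) (auto simp: chain_map_def)

lemma chain_map_cycle:
  assumes "chain_map G H f" "boundary G i v = (\<lambda>_. 0)"
  shows "boundary H i (lin_comb (rank G i) (f i) v) = (\<lambda>_. 0)"
proof (cases i)
  case (Suc m)
  then show ?thesis using assms chain_map_boundary[OF assms(1), of m v] by simp
qed simp

text \<open>The comparison theorem for the identity of \<open>K\<close>: a column is chosen as a
  preimage of a cycle that the previous stage supplies.\<close>

lemma chain_map_exists:
  fixes G H :: "('n::finite, 'k::field) mpoly free_complex"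
  assumes "resolution G a" "resolution H b"
  obtains f where "chain_map G H f" "\<And>k. k < rank G 0 \<Longrightarrow> augmentation H b (f 0 k) = a k"
proof -
  interpret G: resolution G a by fact
  interpret H: resolution H b by fact
  \<comment> \<open>\<open>P\<close> carries along the cycle condition that makes the next lift
    possible; \<open>Q\<close> is the commuting square between consecutive stages.\<close>
  define P where "P = (\<lambda>i c. graded_map G H 0 i c \<and>
    (\<forall>k < rank G (Suc i). H.cycle i (lin_comb (rank G i) c (boundary_column G i k))) \<and>
    (i = 0 \<longrightarrow> (\<forall>k < rank G 0. augmentation H b (c k) = a k)))"
  define Q where "Q = (\<lambda>i c c'. \<forall>k < rank G (Suc i).
    boundary H (Suc i) (c' k) = lin_comb (rank G i) c (boundary_column G i k))"
  have "\<exists>f. \<forall>i. P i (f i) \<and> Q i (f i) (f (Suc i))"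
  proof (rule dependent_nat_choice)
    have "\<forall>k. \<exists>v. k < rank G 0 \<longrightarrow> v \<in> graded_chains UNIV H 0 (twist G 0 k) \<and> augmentation H b v = a k"
      using H.lift_augmentation G.aug_twist by blast
    then obtain c where c: "\<And>k. k < rank G 0 \<Longrightarrow> c k \<in> graded_chains UNIV H 0 (twist G 0 k)"
      "\<And>k. k < rank G 0 \<Longrightarrow> augmentation H b (c k) = a k" by metis
    have "augmentation H b (lin_comb (rank G 0) c v) = augmentation G a v" for v
      using c(2) by (simp add: augmentation_lin_comb) (simp add: augmentation_def mult.commute)
    then have "P 0 c"
      using c G.cycle_boundary_column[of _ 0]
      by (auto simp: P_def H.cycle_def G.cycle_def graded_map_def)
    then show "\<exists>c. P 0 c" by blast
  next
    fix c i assume P: "P i c"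
    have "lin_comb (rank G i) c (boundary_column G i k) \<in> graded_chains UNIV H i (twist G (Suc i) k)"
      if "k < rank G (Suc i)" for k
      using P graded_map_lin_comb[OF _ is_ideal_UNIV G.boundary_column_mem[OF that], of H 0 c]
      by (simp add: P_def)
    then obtain c' where c': "\<And>k. k < rank G (Suc i) \<Longrightarrow> c' k \<in> graded_chains UNIV H (Suc i) (twist G (Suc i) k)"
      and Q: "\<And>k. k < rank G (Suc i) \<Longrightarrow>
        boundary H (Suc i) (c' k) = lin_comb (rank G i) c (boundary_column G i k)"
      using P H.graded_exact_family[of "rank G (Suc i)" "\<lambda>k. lin_comb (rank G i) c (boundary_column G i k)" i "twist G (Suc i)"]
      by (auto simp: P_def)
    have "boundary H (Suc i) (lin_comb (rank G (Suc i)) c' v) = lin_comb (rank G i) c (boundary G (Suc i) v)" for v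
      unfolding boundary_lin_comb boundary_Suc_eq[of G] lin_comb_assoc using Q by (rule lin_comb_cong)
    then have "H.cycle (Suc i) (lin_comb (rank G (Suc i)) c' (boundary_column G (Suc i) k))"
      if "k < rank G (Suc (Suc i))" for k
      using G.cycle_boundary_column[OF that] by (simp add: H.cycle_def G.cycle_def)
    then have "P (Suc i) c'" using c' by (simp add: P_def graded_map_def)
    moreover have "Q i c c'" using Q by (simp add: Q_def)
    ultimately show "\<exists>c'. P (Suc i) c' \<and> Q i c c'" by blast
  qed
  then obtain f where "\<forall>i. P i (f i) \<and> Q i (f i) (f (Suc i))" by blast
  then have "chain_map G H f" "\<And>k. k < rank G 0 \<Longrightarrow> augmentation H b (f 0 k) = a k"
    by (auto simp: chain_map_def P_def Q_def)
  then show thesis by (rule that)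
qed

lemma null_homotopy_exists:
  fixes G :: "('n::finite, 'k::field) mpoly free_complex"
  assumes "resolution G a" and f: "chain_map G G f"
    and f0: "\<And>k. k < rank G 0 \<Longrightarrow> augmentation G a (f 0 k) = 0"
  obtains s where "\<And>i. graded_map G G 1 i (s i)"
    and "\<And>k. k < rank G 0 \<Longrightarrow> boundary G (Suc 0) (s 0 k) = f 0 k"
    and "\<And>i k. k < rank G (Suc i) \<Longrightarrow> boundary G (Suc (Suc i)) (s (Suc i) k)
        = (\<lambda>l. f (Suc i) k l - lin_comb (rank G i) (s i) (boundary_column G i k) l)"
proof -
  interpret resolution G a by fact
  \<comment> \<open>The middle condition is \<open>(f - d s) d = 0\<close>. It says that
    \<open>f - s d\<close> in the next position is a cycle, as
    \<open>d (f - s d) = f d - d s d\<close>; and it is inherited, because there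
    \<open>f - d s\<close> equals \<open>s d\<close> and \<open>d d = 0\<close>.\<close>
  define P where "P = (\<lambda>i c. graded_map G G 1 i c \<and>
    (\<forall>k < rank G (Suc i). lin_comb (rank G i) (\<lambda>k' l. f i k' l - boundary G (Suc i) (c k') l)
        (boundary_column G i k) = (\<lambda>_. 0)) \<and>
    (i = 0 \<longrightarrow> (\<forall>k < rank G 0. boundary G (Suc 0) (c k) = f 0 k)))"
  define Q where "Q = (\<lambda>i c c'. \<forall>k < rank G (Suc i). boundary G (Suc (Suc i)) (c' k)
        = (\<lambda>l. f (Suc i) k l - lin_comb (rank G i) c (boundary_column G i k) l))"
  have fmem: "f i k \<in> graded_chains UNIV G i (twist G i k)" if "k < rank G i" for i k
    using f that by (simp add: chain_map_def graded_map_def)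
  have fbd: "boundary G (Suc i) (f (Suc i) k) = lin_comb (rank G i) (f i) (boundary_column G i k)"
    if "k < rank G (Suc i)" for i k
    using f that by (simp add: chain_map_def)
  have "\<exists>s. \<forall>i. P i (s i) \<and> Q i (s i) (s (Suc i))"
  proof (rule dependent_nat_choice)
    obtain c where "\<And>k. k < rank G 0 \<Longrightarrow> c k \<in> graded_chains UNIV G (Suc 0) (twist G 0 k)"
      and c: "\<And>k. k < rank G 0 \<Longrightarrow> boundary G (Suc 0) (c k) = f 0 k"
      by (rule graded_exact_family[of "rank G 0" "f 0" 0 "twist G 0"]) (auto simp: fmem f0 cycle_def)
    moreover from c have "lin_comb (rank G 0) (\<lambda>k' l. f 0 k' l - boundary G (Suc 0) (c k') l) v = (\<lambda>_. 0)" for v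
      by (simp add: lin_comb_def)
    ultimately have "P 0 c" by (simp add: P_def graded_map_def)
    then show "\<exists>c. P 0 c" by blast
  next
    fix c i assume P: "P i c"
    define v where "v = (\<lambda>k l. f (Suc i) k l - lin_comb (rank G i) c (boundary_column G i k) l)"
    have "v k \<in> graded_chains UNIV G (Suc i) (twist G (Suc i) k)" if "k < rank G (Suc i)" for k
      unfolding v_def
      using P graded_map_lin_comb[OF _ is_ideal_UNIV boundary_column_mem[OF that], of G 1 c]
      by (intro graded_chains_diff is_ideal_UNIV fmem that) (auto simp: P_def)
    moreover have "cycle (Suc i) (v k)" if "k < rank G (Suc i)" for k
    proof -
      have "boundary G (Suc i) (v k) = lin_comb (rank G i) (\<lambda>k' l. f i k' l - boundary G (Suc i) (c k') l)
        (boundary_column G i k)"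
        by (simp add: v_def boundary_diff fbd[OF that] boundary_lin_comb lin_comb_diff_left)
      then show ?thesis using P that by (simp add: P_def cycle_def)
    qed
    ultimately obtain c' where
      c': "\<And>k. k < rank G (Suc i) \<Longrightarrow> c' k \<in> graded_chains UNIV G (Suc (Suc i)) (twist G (Suc i) k)"
      and Q: "\<And>k. k < rank G (Suc i) \<Longrightarrow> boundary G (Suc (Suc i)) (c' k) = v k"
      using graded_exact_family[of "rank G (Suc i)" v "Suc i" "twist G (Suc i)"] by metis
    have "lin_comb (rank G (Suc i)) (\<lambda>k' l. f (Suc i) k' l - boundary G (Suc (Suc i)) (c' k') l)
        (boundary_column G (Suc i) k) = (\<lambda>_. 0)" if "k < rank G (Suc (Suc i))" for k
    proof -
      have "lin_comb (rank G (Suc i)) (\<lambda>k' l. f (Suc i) k' l - boundary G (Suc (Suc i)) (c' k') l)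
          (boundary_column G (Suc i) k)
        = lin_comb (rank G (Suc i)) (\<lambda>k'. lin_comb (rank G i) c (boundary_column G i k'))
          (boundary_column G (Suc i) k)"
        by (rule lin_comb_cong) (simp add: Q v_def)
      also have "\<dots> = lin_comb (rank G i) c (boundary G (Suc i) (boundary_column G (Suc i) k))"
        by (simp add: boundary_Suc_eq lin_comb_assoc)
      finally show ?thesis using cycle_boundary_column[OF that] by (simp add: cycle_def)
    qed
    then have "P (Suc i) c'" using c' by (simp add: P_def graded_map_def)
    moreover have "Q i c c'" using Q by (simp add: Q_def v_def)
    ultimately show "\<exists>c'. P (Suc i) c' \<and> Q i c c'" by blast
  qed
  then obtain s where "\<forall>i. P i (s i) \<and> Q i (s i) (s (Suc i))" by blast
  then show thesis by (intro that[of s]) (auto simp: P_def Q_def)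
qed

text \<open>
  The identity of \<open>I \<otimes> G\<close> factors up to homotopy through \<open>I \<otimes> H\<close>, so exactness passes from
  \<open>I \<otimes> H\<close> to \<open>I \<otimes> G\<close>.
\<close>

lemma exact_tensor_transfer:
  fixes G H :: "('n::finite, 'k::field) mpoly free_complex"
  assumes "resolves_field G" "resolves_field H" and I: "is_ideal I"
    and exact_H: "{v \<in> graded_chains I H i j. boundary H i v = (\<lambda>_. 0)}
      \<subseteq> boundary H (Suc i) ` graded_chains I H (Suc i) j"
  shows "{v \<in> graded_chains I G i j. boundary G i v = (\<lambda>_. 0)}
      \<subseteq> boundary G (Suc i) ` graded_chains I G (Suc i) j"
proof safe
  obtain a b where G: "resolution G a" and H: "resolution H b"
    using assms by (auto simp: resolves_field_iff)
  interpret G: resolution G a by fact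
  obtain f where f: "chain_map G H f" "\<And>k. k < rank G 0 \<Longrightarrow> augmentation H b (f 0 k) = a k"
    using chain_map_exists[OF G H] by metis
  obtain g where g: "chain_map H G g" "\<And>k. k < rank H 0 \<Longrightarrow> augmentation G a (g 0 k) = b k"
    using chain_map_exists[OF H G] by metis
  \<comment> \<open>\<open>e\<close> is \<open>g f - id\<close>; it induces 0 on \<open>K\<close>
    and is therefore null-homotopic.\<close>
  define e where "e = (\<lambda>i k l. lin_comb (rank H i) (g i) (f i k) l - basis_vec k l)"
  have graded: "graded_map G H 0 i (f i)" "graded_map H G 0 i (g i)" for i
    using f g by (simp_all add: chain_map_def)
  have e: "chain_map G G e"
    unfolding chain_map_def
  proof (intro allI conjI impI)
    fix i
    have "e i k \<in> graded_chains UNIV G i (twist G i k)" if "k < rank G i" for k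
      using graded(1)[of i] graded_map_lin_comb[OF graded(2) is_ideal_UNIV, of "f i k" i "twist G i k"] that
      unfolding e_def
      by (intro graded_chains_diff is_ideal_UNIV basis_vec_mem) (auto simp: graded_map_def)
    then show "graded_map G G 0 i (e i)" by (simp add: graded_map_def)
    fix k assume k: "k < rank G (Suc i)"
    have "boundary G (Suc i) (e (Suc i) k)
      = (\<lambda>l. lin_comb (rank H i) (g i) (lin_comb (rank G i) (f i) (boundary_column G i k)) l
          - boundary_column G i k l)"
      using k f by (simp add: e_def boundary_diff chain_map_boundary[OF g(1)] chain_map_def)
        (simp add: boundary_Suc_eq lin_comb_basis_vec)
    also have "\<dots> = lin_comb (rank G i) (e i) (boundary_column G i k)"
      using lin_comb_of_basis[of "rank G i" "boundary_column G i k"]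
      by (simp add: e_def lin_comb_diff_left lin_comb_assoc boundary_column_def)
    finally show "boundary G (Suc i) (e (Suc i) k) = lin_comb (rank G i) (e i) (boundary_column G i k)" .
  qed
  have e0: "augmentation G a (e 0 k) = 0" if "k < rank G 0" for k
  proof -
    have "augmentation G a (lin_comb (rank H 0) (g 0) (f 0 k)) = augmentation H b (f 0 k)"
      using g(2) by (simp add: augmentation_lin_comb) (simp add: augmentation_def mult.commute)
    moreover have "augmentation G a (basis_vec k) = (\<Sum>k' < rank G 0. if k' = k then a k' else 0)"
      unfolding augmentation_def basis_vec_def by (rule sum.cong) auto
    ultimately show ?thesis using that f(2) by (simp add: e_def augmentation_diff)
  qed
  obtain s where s: "\<And>i. graded_map G G 1 i (s i)"
    and s0: "\<And>k. k < rank G 0 \<Longrightarrow> boundary G (Suc 0) (s 0 k) = e 0 k"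
    and sSuc: "\<And>i k. k < rank G (Suc i) \<Longrightarrow> boundary G (Suc (Suc i)) (s (Suc i) k)
        = (\<lambda>l. e (Suc i) k l - lin_comb (rank G i) (s i) (boundary_column G i k) l)"
    by (rule null_homotopy_exists[OF G e e0]) blast+

  fix v assume v: "v \<in> graded_chains I G i j" "boundary G i v = (\<lambda>_. 0)"
  \<comment> \<open>In \<open>e = d s + s d\<close> the second term vanishes on the cycle
    \<open>v\<close>.\<close>
  have e_v: "lin_comb (rank G i) (e i) v = boundary G (Suc i) (lin_comb (rank G i) (s i) v)"
  proof (cases i)
    case 0
    show ?thesis unfolding boundary_lin_comb 0 by (intro lin_comb_cong) (simp add: s0)
  next
    case (Suc m)
    have "boundary G (Suc i) (lin_comb (rank G i) (s i) v)
      = lin_comb (rank G i) (\<lambda>k l. e i k l - lin_comb (rank G m) (s m) (boundary_column G m k) l) v"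
      unfolding boundary_lin_comb Suc by (rule lin_comb_cong) (rule sSuc)
    also have "\<dots> = (\<lambda>l. lin_comb (rank G i) (e i) v l - lin_comb (rank G m) (s m) (boundary G i v) l)"
      by (simp add: lin_comb_diff_left lin_comb_assoc Suc boundary_Suc_eq)
    finally show ?thesis by (simp add: v)
  qed
  have "lin_comb (rank G i) (f i) v \<in> graded_chains I H i j"
    using graded_map_lin_comb[OF graded(1) I v(1)] by simp
  then have "lin_comb (rank G i) (f i) v \<in> boundary H (Suc i) ` graded_chains I H (Suc i) j"
    using chain_map_cycle[OF f(1) v(2)] by (intro subsetD[OF exact_H]) simp
  then obtain w where w: "w \<in> graded_chains I H (Suc i) j"
    "lin_comb (rank G i) (f i) v = boundary H (Suc i) w"
    by blast
  \<comment> \<open>With \<open>f v = d w\<close>, the identity \<open>g f v - v = d s v\<close>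
    becomes \<open>v = d (g w - s v)\<close>.\<close>
  define u where "u = (\<lambda>l. lin_comb (rank H (Suc i)) (g (Suc i)) w l - lin_comb (rank G i) (s i) v l)"
  have "u \<in> graded_chains I G (Suc i) j"
    unfolding u_def
    using graded_map_lin_comb[OF graded(2) I w(1)] graded_map_lin_comb[OF s I v(1)]
    by (intro graded_chains_diff I) auto
  moreover have "boundary G (Suc i) u = v"
  proof -
    have "lin_comb (rank G i) basis_vec v = v"
      using graded_chainsD(2)[OF v(1)] by (intro lin_comb_of_basis) auto
    then have "lin_comb (rank G i) (e i) v
        = (\<lambda>l. lin_comb (rank H i) (g i) (lin_comb (rank G i) (f i) v) l - v l)"
      by (simp add: e_def lin_comb_diff_left lin_comb_assoc)
    then show ?thesis
      by (simp add: u_def boundary_diff chain_map_boundary[OF g(1)] w(2) flip: e_v)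
  qed
  ultimately show "v \<in> boundary G (Suc i) ` graded_chains I G (Suc i) j" by blast
qed


section \<open>The Koszul complex\<close>

(* keeps unit exponents in the form Poly_Mapping.single i 1 *)
declare One_nat_def [simp del]

section \<open>The augmented chain complex of a simplex and its cone\<close>

definition face_sign :: "'n::{finite,linorder} \<Rightarrow> 'n set \<Rightarrow> 'k::field"
  where "face_sign x F = (- 1) ^ card {y \<in> F. x < y}"

lemma face_sign_nonzero [simp]: "face_sign x F \<noteq> (0::'k::field)"
  by (simp add: face_sign_def)

text \<open>The reason for counting the vertices above \<open>x\<close>, not below: coning with the
  largest vertex then needs no sign.\<close>

lemma face_sign_above: "\<forall>y\<in>F. y \<le> x \<Longrightarrow> face_sign x F = 1"
proof -
  assume "\<forall>y\<in>F. y \<le> x"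
  then have "{y \<in> F. x < y} = {}" by (auto simp: not_less)
  then show ?thesis by (simp only: face_sign_def card.empty power_0)
qed

lemma face_sign_insert:
  assumes "y \<notin> F"
  shows "face_sign x (insert y F) = (if x < y then - face_sign x F else face_sign x F)"
proof -
  have "{z \<in> insert y F. x < z} = (if x < y then insert y {z \<in> F. x < z} else {z \<in> F. x < z})" by auto
  then show ?thesis using assms by (simp add: face_sign_def)
qed

text \<open>Chains are coefficient functions, so the coefficient of \<open>F\<close> in the boundary
  collects from the faces having \<open>F\<close> as a facet. The empty face is included.\<close>

definition simplex_boundary :: "'n::{finite,linorder} set \<Rightarrow> ('n set \<Rightarrow> 'k::field) \<Rightarrow> 'n set \<Rightarrow> 'k"
  where "simplex_boundary A \<zeta> F = (\<Sum>x\<in>A - F. face_sign x F * \<zeta> (insert x F))"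

definition cone :: "'n \<Rightarrow> ('n set \<Rightarrow> 'k::zero) \<Rightarrow> 'n set \<Rightarrow> 'k"
  where "cone m \<zeta> F = (if m \<in> F then \<zeta> (F - {m}) else 0)"

text \<open>Adding \<open>x\<close> and then \<open>y\<close>, or \<open>y\<close> and then
  \<open>x\<close>, gives opposite signs; the double sum is split by the order of the two and one
  half is reindexed.\<close>

lemma simplex_boundary_boundary: "simplex_boundary A (simplex_boundary A \<zeta>) F = 0"
proof -
  define g where "g = (\<lambda>x y. face_sign x F * face_sign y (insert x F) * \<zeta> (insert y (insert x F)))"
  let ?B = "A - F"
  have anti: "g x y = - g y x" if "x \<in> ?B" "y \<in> ?B" "x < y" for x y
    using that by (auto simp: g_def face_sign_insert insert_commute)
  have "simplex_boundary A (simplex_boundary A \<zeta>) F = (\<Sum>x\<in>?B. \<Sum>y\<in>{y \<in> ?B. y \<noteq> x}. g x y)"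
    unfolding simplex_boundary_def g_def
    by (auto simp: sum_distrib_left mult.assoc intro!: sum.cong)
  also have "\<dots> = (\<Sum>x\<in>?B. (\<Sum>y\<in>{y \<in> ?B. x < y}. g x y) + (\<Sum>y\<in>{y \<in> ?B. y < x}. g x y))"
    by (intro sum.cong refl, subst sum.union_disjoint[symmetric]) (auto intro!: sum.cong)
  also have "\<dots> = (\<Sum>x\<in>?B. \<Sum>y\<in>{y \<in> ?B. x < y}. g x y) + (\<Sum>x\<in>?B. \<Sum>y\<in>{y \<in> ?B. y < x}. g x y)"
    by (rule sum.distrib)
  also have "(\<Sum>x\<in>?B. \<Sum>y\<in>{y \<in> ?B. y < x}. g x y) = (\<Sum>y\<in>?B. \<Sum>x\<in>{x \<in> ?B. y < x}. g x y)"
    by (rule sum.swap_restrict) auto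
  also have "\<dots> = (\<Sum>y\<in>?B. \<Sum>x\<in>{x \<in> ?B. y < x}. - g y x)"
  proof (intro sum.cong refl)
    fix x y assume "x \<in> ?B" "y \<in> {y \<in> ?B. x < y}"
    then show "g y x = - g x y" using anti[of x y] by simp
  qed
  finally show ?thesis by (simp add: sum_negf)
qed

text \<open>If \<open>m\<close> lies in \<open>F\<close>, every other \<open>x\<close> is below
  \<open>m\<close> and changes sign when \<open>m\<close> is inserted, so only \<open>x = m\<close>
  in the second summand survives. Otherwise the second summand is 0 and only \<open>x = m\<close>
  counts in the first.\<close>

lemma simplex_boundary_cone:
  fixes A F :: "'n::{finite,linorder} set" and \<zeta> :: "'n set \<Rightarrow> 'k::field"
  assumes "m \<in> A" and max: "\<And>x. x \<in> A \<Longrightarrow> x \<le> m" and "F \<subseteq> A"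
  shows "simplex_boundary A (cone m \<zeta>) F + cone m (simplex_boundary A \<zeta>) F = \<zeta> F"
proof (cases "m \<in> F")
  case True
  define F' where "F' = F - {m}"
  have F: "F = insert m F'" "m \<notin> F'" using True by (auto simp: F'_def)
  have sgn: "face_sign x F = - face_sign x F'" if "x \<in> A - F" for x
    using that max[of x] F by (auto simp: face_sign_insert)
  have "A - F' = insert m (A - F)" using F assms(1) by auto
  then have "cone m (simplex_boundary A \<zeta>) F
      = face_sign m F' * \<zeta> F + (\<Sum>x\<in>A - F. face_sign x F' * \<zeta> (insert x F'))"
    using True F by (simp add: cone_def simplex_boundary_def flip: F'_def)
  moreover have "face_sign m F' = (1::'k)"
    using max assms(3) by (intro face_sign_above) (auto simp: F'_def)
  moreover have "simplex_boundary A (cone m \<zeta>) F = (\<Sum>x\<in>A - F. - (face_sign x F' * \<zeta> (insert x F')))"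
    unfolding simplex_boundary_def
  proof (rule sum.cong)
    fix x assume x: "x \<in> A - F"
    then have "insert x F - {m} = insert x F'" using F by auto
    then show "face_sign x F * cone m \<zeta> (insert x F) = - (face_sign x F' * \<zeta> (insert x F'))"
      using True by (simp add: cone_def sgn[OF x])
  qed simp
  ultimately show ?thesis by (simp add: sum_negf)
next
  case False
  have "simplex_boundary A (cone m \<zeta>) F = (\<Sum>x\<in>A - F. if x = m then face_sign m F * \<zeta> F else 0)"
    unfolding simplex_boundary_def by (rule sum.cong) (use False in \<open>auto simp: cone_def\<close>)
  moreover have "face_sign m F = (1::'k)"
    using max assms(3) by (intro face_sign_above) auto
  ultimately show ?thesis using False assms(1) by (simp add: cone_def)
qed

section \<open>Numbering of the faces\<close>

definition num_faces :: "'n::finite itself \<Rightarrow> nat \<Rightarrow> nat"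
  where "num_faces _ i = card {F :: 'n set. card F = i}"

text \<open>Bases of a \<open>free_complex\<close> are numbered, so faces of each cardinality are
  enumerated; any bijection serves, as only its inverse laws are used.\<close>

definition face :: "nat \<Rightarrow> nat \<Rightarrow> 'n::finite set"
  where "face i = (SOME f. bij_betw f {..<num_faces TYPE('n) i} {F. card F = i})"

definition face_index :: "'n::finite set \<Rightarrow> nat"
  where "face_index F = inv_into {..<num_faces TYPE('n) (card F)} (face (card F)) F"

lemma bij_betw_face: "bij_betw (face i) {..<num_faces TYPE('n::finite) i} {F :: 'n set. card F = i}"
proof -
  have "\<exists>f. bij_betw f {..<num_faces TYPE('n) i} {F :: 'n set. card F = i}"
    using ex_bij_betw_nat_finite[of "{F :: 'n set. card F = i}"]
    by (simp add: num_faces_def atLeast0LessThan)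
  then show ?thesis unfolding face_def by (rule someI_ex)
qed

lemma card_face [simp]: "k < num_faces TYPE('n::finite) i \<Longrightarrow> card (face i k :: 'n set) = i"
  using bij_betwE[OF bij_betw_face[of i]] by auto

lemma face_index_less: "face_index (F :: 'n::finite set) < num_faces TYPE('n) (card F)"
  unfolding face_index_def using bij_betw_face[of "card F"]
  by (metis (mono_tags, lifting) bij_betw_def inv_into_into lessThan_iff mem_Collect_eq)

lemma face_face_index: "face (card F) (face_index F) = (F :: 'n::finite set)"
  unfolding face_index_def using bij_betw_face[of "card F"]
  by (metis (mono_tags, lifting) bij_betw_inv_into_right mem_Collect_eq)

lemma face_index_face:
  assumes "k < num_faces TYPE('n::finite) i"
  shows "face_index (face i k :: 'n set) = k"
  unfolding face_index_def card_face[OF assms]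
  by (rule bij_betw_inv_into_left[OF bij_betw_face]) (use assms in simp)

lemma eq_face_iff:
  "k < num_faces TYPE('n::finite) i \<Longrightarrow> card F = i \<Longrightarrow> (F :: 'n set) = face i k \<longleftrightarrow> k = face_index F"
  using face_index_face face_face_index by metis

lemma num_faces_0: "num_faces TYPE('n::finite) 0 = 1"
proof -
  have "{F :: 'n set. card F = 0} = {{}}" by auto
  then show ?thesis by (simp add: num_faces_def)
qed

lemma face_index_empty: "face_index ({} :: 'n::finite set) = 0"
  using face_index_less[of "{} :: 'n set"] by (simp add: num_faces_0)

text \<open>At most one summand of an entry is nonzero: the signed variable that completes the row
  face to the column face.\<close>

definition koszul :: "('n::{finite,linorder}, 'k::field) mpoly free_complex"
  where "koszul = \<lparr>rank = num_faces TYPE('n), twist = (\<lambda>i k. int i),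
    dmat = (\<lambda>i l k. \<Sum>x\<in>- face i l. if insert x (face i l) = (face (Suc i) k :: 'n set)
      then Poly_Mapping.single (unit_expo x) (face_sign x (face i l)) else 0)\<rparr>"

lemma rank_koszul [simp]:
    "rank (koszul :: ('n::{finite,linorder}, 'k::field) mpoly free_complex) = num_faces TYPE('n)"
  and twist_koszul [simp]: "twist (koszul :: ('n, 'k) mpoly free_complex) i k = int i"
  by (simp_all add: koszul_def)

lemma boundary_koszul:
  fixes v :: "nat \<Rightarrow> ('n::{finite,linorder}, 'k::field) mpoly"
  assumes "card F = i"
  shows "boundary koszul (Suc i) v (face_index F)
    = (\<Sum>x\<in>- F. Poly_Mapping.single (unit_expo x) (face_sign x F) * v (face_index (insert x F)))"
proof -
  have F: "face i (face_index F) = F" "face_index F < num_faces TYPE('n) i"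
    using face_face_index[of F] face_index_less[of F] assms by auto
  let ?s = "\<lambda>x. Poly_Mapping.single (unit_expo x) (face_sign x F)"
  have "boundary koszul (Suc i) v (face_index F) = (\<Sum>k < num_faces TYPE('n) (Suc i).
      (\<Sum>x\<in>- F. if insert x F = face (Suc i) k then ?s x else 0) * v k)"
    using F by (simp add: boundary.simps koszul_def cong: if_cong)
  also have "\<dots> = (\<Sum>x\<in>- F. \<Sum>k < num_faces TYPE('n) (Suc i).
      if insert x F = face (Suc i) k then ?s x * v k else 0)"
    by (simp add: sum_distrib_right, subst sum.swap) (auto intro!: sum.cong)
  also have "\<dots> = (\<Sum>x\<in>- F. ?s x * v (face_index (insert x F)))"
  proof (rule sum.cong)
    fix x assume "x \<in> - F"
    then have c: "card (insert x F) = Suc i" using assms by simp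
    then have "(\<Sum>k < num_faces TYPE('n) (Suc i). if insert x F = face (Suc i) k then ?s x * v k else 0)
      = (\<Sum>k < num_faces TYPE('n) (Suc i). if k = face_index (insert x F) then ?s x * v k else 0)"
      by (intro sum.cong) (auto simp: eq_face_iff[OF _ c])
    then show "(\<Sum>k < num_faces TYPE('n) (Suc i). if insert x F = face (Suc i) k then ?s x * v k else 0)
      = ?s x * v (face_index (insert x F))"
      using face_index_less[of "insert x F"] c by simp
  qed simp
  finally show ?thesis .
qed

lemma lookup_boundary_koszul:
  fixes v :: "nat \<Rightarrow> ('n::{finite,linorder}, 'k::field) mpoly"
  assumes "card F = i"
  shows "lookup (boundary koszul (Suc i) v (face_index F)) t
    = (\<Sum>x\<in>keys t - F. face_sign x F * lookup (v (face_index (insert x F))) (t - unit_expo x))"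
proof -
  have "lookup (boundary koszul (Suc i) v (face_index F)) t
    = (\<Sum>x\<in>- F. if x \<in> keys t then face_sign x F * lookup (v (face_index (insert x F))) (t - unit_expo x) else 0)"
    by (simp add: boundary_koszul[OF assms] lookup_sum lookup_single_times)
  also have "\<dots> = (\<Sum>x\<in>keys t - F. face_sign x F * lookup (v (face_index (insert x F))) (t - unit_expo x))"
    by (rule sum.mono_neutral_cong_right) auto
  finally show ?thesis .
qed

text \<open>
  The multidegree \<open>a\<close> part of \<open>S \<otimes> koszul\<close> is the augmented chain complex of the full simplex on
  the support of \<open>a\<close>: a face \<open>F\<close> carries the coefficient of the monomial with exponent \<open>a - 1\<^sub>F\<close>.
\<close>

definition face_expo :: "'n::finite set \<Rightarrow> 'n expo"
  where "face_expo F = (\<Sum>x\<in>F. unit_expo x)"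

lemma lookup_face_expo: "lookup (face_expo F) x = (if x \<in> F then 1 else 0)"
  by (simp add: face_expo_def lookup_sum lookup_single when_def)

definition multidegree_part :: "'n expo \<Rightarrow> (nat \<Rightarrow> ('n::{finite,linorder}, 'k::field) mpoly) \<Rightarrow> 'n set \<Rightarrow> 'k"
  where "multidegree_part a v F = lookup (v (face_index F)) (a - face_expo F)"

text \<open>For \<open>F \<subseteq> keys a\<close> the subtraction of exponents is exact. The
  second identity recovers the support of \<open>a\<close> from the pair of monomial and face, which
  is how the cone finds its apex.\<close>

lemma face_expo_simps:
  assumes "F \<subseteq> keys a"
  shows "keys (a - face_expo F) - F = keys a - F"
    and "keys (a - face_expo F) \<union> F = keys a"
    and "x \<notin> F \<Longrightarrow> a - face_expo F - unit_expo x = a - face_expo (insert x F)"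
    and "x \<in> F \<Longrightarrow> a - face_expo F + unit_expo x = a - face_expo (F - {x})"
proof -
  show "keys (a - face_expo F) - F = keys a - F" "keys (a - face_expo F) \<union> F = keys a"
    using assms by (auto simp: in_keys_iff lookup_minus lookup_face_expo split: if_splits)
  show "x \<notin> F \<Longrightarrow> a - face_expo F - unit_expo x = a - face_expo (insert x F)"
    by (rule poly_mapping_eqI) (auto simp: lookup_minus lookup_face_expo lookup_single when_def)
  show "x \<in> F \<Longrightarrow> a - face_expo F + unit_expo x = a - face_expo (F - {x})"
    using assms by (intro poly_mapping_eqI)
      (auto simp: lookup_minus lookup_add lookup_face_expo lookup_single when_def in_keys_iff subset_iff)
qed

lemma multidegree_part_boundary:
  assumes "card F = i" "F \<subseteq> keys a"
  shows "multidegree_part a (boundary koszul (Suc i) v) F = simplex_boundary (keys a) (multidegree_part a v) F"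
  by (simp add: multidegree_part_def lookup_boundary_koszul[OF assms(1)] simplex_boundary_def
      face_expo_simps[OF assms(2)])

text \<open>The coefficient of \<open>t\<close> at the face \<open>F\<close> belongs to the
  multidegree \<open>t + face_expo F\<close>, whose support contains \<open>F\<close>; so the
  multidegree parts see everything.\<close>

lemma koszul_eqI:
  fixes v w :: "nat \<Rightarrow> ('n::{finite,linorder}, 'k::field) mpoly"
  assumes "\<And>k. k \<ge> num_faces TYPE('n) i \<Longrightarrow> v k = w k"
    and "\<And>F a. card F = i \<Longrightarrow> F \<subseteq> keys a \<Longrightarrow> multidegree_part a v F = multidegree_part a w F"
  shows "v = w"
proof
  fix k show "v k = w k"
  proof (cases "k < num_faces TYPE('n) i")
    case True
    let ?F = "face i k :: 'n set"
    show ?thesis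
    proof (rule poly_mapping_eqI)
      fix t
      have "?F \<subseteq> keys (t + face_expo ?F)"
        by (auto simp: in_keys_iff lookup_add lookup_face_expo)
      then have "multidegree_part (t + face_expo ?F) v ?F = multidegree_part (t + face_expo ?F) w ?F"
        using True by (intro assms(2)) auto
      then show "lookup (v k) t = lookup (w k) t"
        by (simp add: multidegree_part_def face_index_face[OF True])
    qed
  qed (simp add: assms(1))
qed

lemma boundary_boundary_koszul:
  "boundary (koszul :: ('n::{finite,linorder}, 'k::field) mpoly free_complex) i (boundary koszul (Suc i) v) = (\<lambda>_. 0)"
proof (cases i)
  case (Suc m)
  show ?thesis
  proof (rule koszul_eqI)
    show "boundary koszul i (boundary koszul (Suc i) v) k = 0" if "k \<ge> num_faces TYPE('n) m" for k
      unfolding Suc using that by (intro boundary_beyond_rank) simp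
    fix F :: "'n set" and a :: "'n expo" assume F: "card F = m" "F \<subseteq> keys a"
    have "multidegree_part a (boundary koszul i (boundary koszul (Suc i) v)) F
        = simplex_boundary (keys a) (multidegree_part a (boundary koszul (Suc i) v)) F"
      unfolding Suc by (rule multidegree_part_boundary[OF F])
    also have "\<dots> = simplex_boundary (keys a) (simplex_boundary (keys a) (multidegree_part a v)) F"
      unfolding simplex_boundary_def[of "keys a" _ F]
      using F Suc by (intro sum.cong refl arg_cong2[of _ _ _ _ "(*)"] multidegree_part_boundary) auto
    finally show "multidegree_part a (boundary koszul i (boundary koszul (Suc i) v)) F
        = multidegree_part a (\<lambda>_. 0) F"
      by (simp add: simplex_boundary_boundary multidegree_part_def)
  qed
qed simp

text \<open>Coning with the largest element of the support, in every multidegree.\<close>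

definition koszul_cone ::
    "nat \<Rightarrow> (nat \<Rightarrow> ('n::{finite,linorder}, 'k::field) mpoly) \<Rightarrow> nat \<Rightarrow> ('n, 'k) mpoly"
  where "koszul_cone i v l = (if l < num_faces TYPE('n) (Suc i) then
    Abs_poly_mapping (\<lambda>s. let F = face (Suc i) l; m = Max (keys s \<union> F) in
      if m \<in> F then lookup (v (face_index (F - {m}))) (s + unit_expo m) else 0) else 0)"

text \<open>The point is finite support: a nonzero value at \<open>s\<close> comes from a key
  \<open>s + unit_expo m\<close> of one of the finitely many coordinates of \<open>v\<close>
  involved.\<close>

lemma lookup_koszul_cone:
  fixes v :: "nat \<Rightarrow> ('n::{finite,linorder}, 'k::field) mpoly"
  assumes "l < num_faces TYPE('n) (Suc i)"
  defines "F \<equiv> face (Suc i) l"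
  shows "lookup (koszul_cone i v l) s = (if Max (keys s \<union> F) \<in> F
    then lookup (v (face_index (F - {Max (keys s \<union> F)}))) (s + unit_expo (Max (keys s \<union> F))) else 0)"
proof -
  let ?f = "\<lambda>s. if Max (keys s \<union> F) \<in> F
    then lookup (v (face_index (F - {Max (keys s \<union> F)}))) (s + unit_expo (Max (keys s \<union> F))) else 0"
  have "{s. ?f s \<noteq> 0} \<subseteq> (\<Union>m\<in>F. (\<lambda>t. t - unit_expo m) ` keys (v (face_index (F - {m}))))"
  proof
    fix s assume "s \<in> {s. ?f s \<noteq> 0}"
    then have "Max (keys s \<union> F) \<in> F"
      "s + unit_expo (Max (keys s \<union> F)) \<in> keys (v (face_index (F - {Max (keys s \<union> F)})))"
      by (auto simp: in_keys_iff split: if_splits)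
    then show "s \<in> (\<Union>m\<in>F. (\<lambda>t. t - unit_expo m) ` keys (v (face_index (F - {m}))))"
      by (intro UN_I image_eqI[where x = "s + unit_expo (Max (keys s \<union> F))"]) auto
  qed
  then have "finite {s. ?f s \<noteq> 0}" by (rule finite_subset) auto
  then have "lookup (Abs_poly_mapping ?f) s = ?f s" by simp
  then show ?thesis using assms(1) by (simp add: koszul_cone_def Let_def flip: F_def)
qed

lemma multidegree_part_koszul_cone:
  fixes F :: "'n::{finite,linorder} set"
  assumes "card F = Suc i" "F \<subseteq> keys a"
  shows "multidegree_part a (koszul_cone i v) F = cone (Max (keys a)) (multidegree_part a v) F"
proof -
  have l: "face_index F < num_faces TYPE('n) (Suc i)" "face (Suc i) (face_index F) = F"
    using face_index_less[of F] face_face_index[of F] assms by auto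
  show ?thesis
    unfolding multidegree_part_def cone_def
    using assms by (simp add: lookup_koszul_cone[OF l(1)] l(2) face_expo_simps(2,4))
qed

text \<open>The cone formula in every multidegree; its second summand vanishes because
  \<open>v\<close> is a cycle.\<close>

lemma koszul_contract:
  fixes v :: "nat \<Rightarrow> ('n::{finite,linorder}, 'k::field) mpoly"
  assumes v: "v \<in> chains UNIV koszul i" and cyc: "boundary koszul i v = (\<lambda>_. 0)"
    and v0: "i = 0 \<Longrightarrow> lookup (v 0) 0 = 0"
  shows "boundary koszul (Suc i) (koszul_cone i v) = v"
proof (rule koszul_eqI)
  show "boundary koszul (Suc i) (koszul_cone i v) k = v k" if "k \<ge> num_faces TYPE('n) i" for k
    using v boundary_beyond_rank[of koszul i k "koszul_cone i v"] that by (simp add: chains_def)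
  fix F :: "'n set" and a :: "'n expo" assume F: "card F = i" "F \<subseteq> keys a"
  have eq: "multidegree_part a (boundary koszul (Suc i) (koszul_cone i v)) F
      = simplex_boundary (keys a) (cone (Max (keys a)) (multidegree_part a v)) F"
    unfolding multidegree_part_boundary[OF F] unfolding simplex_boundary_def
    using F by (intro sum.cong refl arg_cong2[of _ _ _ _ "(*)"] multidegree_part_koszul_cone) auto
  show "multidegree_part a (boundary koszul (Suc i) (koszul_cone i v)) F = multidegree_part a v F"
  \<comment> \<open>Multidegree 0 has no vertex to cone with; it carries only the constant term in
    position 0, which is the homology \<open>K\<close> and is excluded by \<open>v0\<close>.\<close>
  proof (cases "keys a = {}")
    case True
    then have "F = {}" "i = 0" "a = 0" using F by auto
    then have "multidegree_part a v F = 0"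
      using v0 by (simp add: multidegree_part_def face_index_empty face_expo_def)
    moreover have "multidegree_part a (boundary koszul (Suc i) (koszul_cone i v)) F = 0"
      using True by (simp only: eq) (simp add: simplex_boundary_def)
    ultimately show ?thesis by simp
  next
    case False
    let ?m = "Max (keys a)"
    have "cone ?m (simplex_boundary (keys a) (multidegree_part a v)) F = 0"
    proof (cases "?m \<in> F")
      case True
      then obtain i' where i: "i = Suc i'" and F': "card (F - {?m}) = i'" "F - {?m} \<subseteq> keys a"
        using F by (cases i) auto
      have "simplex_boundary (keys a) (multidegree_part a v) (F - {?m})
          = multidegree_part a (boundary koszul i v) (F - {?m})"
        unfolding i by (rule multidegree_part_boundary[OF F', symmetric])
      then show ?thesis using cyc by (simp add: cone_def multidegree_part_def)
    qed (simp add: cone_def)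
    then show ?thesis
      using simplex_boundary_cone[of ?m "keys a" F "multidegree_part a v"] False F(2) by (simp add: eq)
  qed
qed

text \<open>A coefficient of the cone at \<open>s\<close> is one of \<open>v\<close> at
  \<open>s x_m\<close>, with \<open>m\<close> at least every variable of \<open>s\<close>; the colon
  hypothesis brings \<open>s\<close> back into \<open>I\<close>.\<close>

lemma koszul_cone_mem:
  fixes v :: "nat \<Rightarrow> ('n::{finite,linorder}, 'k::field) mpoly"
  assumes I: "monomial_ideal I" and v: "v \<in> graded_chains I koszul i j"
    and colon: "\<And>s m. int (expo_deg s) = j - int (Suc i) \<Longrightarrow> (\<forall>x\<in>keys s. x \<le> m)
      \<Longrightarrow> monom (s + unit_expo m) \<in> I \<Longrightarrow> monom s \<in> I"
  shows "koszul_cone i v \<in> graded_chains I koszul (Suc i) j"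
proof (rule graded_chainsI)
  fix k
  show "koszul_cone i v k = 0" if "k \<ge> rank (koszul :: ('n, 'k) mpoly free_complex) (Suc i)"
    using that by (simp add: koszul_cone_def)
  assume "k < rank (koszul :: ('n, 'k) mpoly free_complex) (Suc i)"
  then have k: "k < num_faces TYPE('n) (Suc i)" by simp
  have *: "int (expo_deg s) = j - int (Suc i) \<and> monom s \<in> I" if s: "s \<in> keys (koszul_cone i v k)" for s
  proof -
    define F where "F = (face (Suc i) k :: 'n set)"
    define m where "m = Max (keys s \<union> F)"
    have m: "m \<in> F" and sm: "s + unit_expo m \<in> keys (v (face_index (F - {m})))"
      using s by (auto simp: in_keys_iff lookup_koszul_cone[OF k] m_def F_def split: if_splits)
    have "card (F - {m}) = i" using m k by (simp add: F_def)
    then have l: "face_index (F - {m}) < rank (koszul :: ('n, 'k) mpoly free_complex) i"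
      using face_index_less[of "F - {m}"] by simp
    have d: "int (expo_deg s) = j - int (Suc i)"
      using graded_chainsD(3)[OF v l] sm by (auto simp: homogeneous_def)
    moreover have "monom (s + unit_expo m) \<in> I"
      using graded_chainsD(1)[OF v l] sm mem_monomial_ideal_iff[OF I] by blast
    ultimately have "monom s \<in> I"
      by (intro colon[of s m]) (auto simp: m_def)
    then show ?thesis using d by blast
  qed
  show "koszul_cone i v k \<in> I" using * mem_monomial_ideal_iff[OF I] by blast
  show "homogeneous (j - twist koszul (Suc i) k) (koszul_cone i v k)"
    using * by (simp add: homogeneous_def)
qed

lemma koszul_exact:
  assumes "monomial_ideal (I :: ('n::{finite,linorder}, 'k::field) mpoly set)"
    and "\<And>s m. int (expo_deg s) = j - int (Suc i) \<Longrightarrow> (\<forall>x\<in>keys s. x \<le> m)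
      \<Longrightarrow> monom (s + unit_expo m) \<in> I \<Longrightarrow> monom s \<in> I"
    and "int i < j"
  shows "{v \<in> graded_chains I koszul i j. boundary koszul i v = (\<lambda>_. 0)}
      \<subseteq> boundary koszul (Suc i) ` graded_chains I koszul (Suc i) j"
proof safe
  fix v assume v: "v \<in> graded_chains I koszul i j" "boundary koszul i v = (\<lambda>_. 0)"
  \<comment> \<open>For \<open>i = 0\<close> the coordinates have degree \<open>j > 0\<close>, so
    there is no constant term.\<close>
  have "lookup (v 0) 0 = 0" if "i = 0"
    using graded_chainsD(3)[OF v(1), of 0] that assms(3)
    by (force simp: num_faces_0 homogeneous_def in_keys_iff)
  then have "boundary koszul (Suc i) (koszul_cone i v) = v"
    using v graded_chainsD(4)[OF v(1)] by (intro koszul_contract) auto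
  moreover have "koszul_cone i v \<in> graded_chains I koszul (Suc i) j"
    using assms v by (intro koszul_cone_mem) auto
  ultimately show "v \<in> boundary koszul (Suc i) ` graded_chains I koszul (Suc i) j" by (metis image_eqI)
qed

section \<open>The Koszul complex as a resolution, and Tor computed from it\<close>

lemma koszul_cone_mem_chains: "koszul_cone i v \<in> chains UNIV koszul (Suc i)"
  by (simp add: chains_def koszul_cone_def)

lemma boundary_mem_chains: "boundary G (Suc i) v \<in> chains UNIV G i"
  by (simp add: chains_def boundary_beyond_rank)

lemma resolution_koszul:
  "resolution (koszul :: ('n::{finite,linorder}, 'k::field) mpoly free_complex) (\<lambda>_. 1)"
proof
  let ?K = "koszul :: ('n, 'k) mpoly free_complex"
  have aug: "augmentation ?K (\<lambda>_. 1) v = lookup (v 0) 0" for v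
    by (simp add: augmentation_def num_faces_0 One_nat_def)
  show "homogeneous (twist ?K (Suc i) k - twist ?K i l) (dmat ?K i l k)" for i l k
    by (auto simp: koszul_def intro!: homogeneous_sum homogeneous_single)
  show "twist ?K 0 k = 0" for k by simp
  show "augmentation ?K (\<lambda>_. 1) ` chains UNIV ?K 0 = UNIV"
  proof -
    have "c \<in> augmentation ?K (\<lambda>_. 1) ` chains UNIV ?K 0" for c
      by (rule image_eqI[of _ _ "\<lambda>k. if k = 0 then Poly_Mapping.single 0 c else 0"])
        (auto simp: aug chains_def num_faces_0)
    then show ?thesis by blast
  qed
  show "{v \<in> chains UNIV ?K 0. augmentation ?K (\<lambda>_. 1) v = 0}
      = boundary ?K (Suc 0) ` chains UNIV ?K (Suc 0)"
  proof (intro equalityI subsetI)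
    fix v assume "v \<in> {v \<in> chains UNIV ?K 0. augmentation ?K (\<lambda>_. 1) v = 0}"
    then have "boundary koszul (Suc 0) (koszul_cone 0 v) = v"
      by (intro koszul_contract) (auto simp: aug)
    then show "v \<in> boundary ?K (Suc 0) ` chains UNIV ?K (Suc 0)"
      using koszul_cone_mem_chains by (metis image_eqI)
  next
    fix v assume "v \<in> boundary ?K (Suc 0) ` chains UNIV ?K (Suc 0)"
    then obtain w where "v = boundary ?K (Suc 0) w" by blast
    \<comment> \<open>The constant term of a boundary is a sum over the empty support of the
      exponent 0.\<close>
    then show "v \<in> {v \<in> chains UNIV ?K 0. augmentation ?K (\<lambda>_. 1) v = 0}"
      using lookup_boundary_koszul[of "{} :: 'n set" 0 w 0]
      by (simp add: aug boundary_mem_chains face_index_empty)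
  qed
  show "{v \<in> chains UNIV ?K (Suc i). boundary ?K (Suc i) v = (\<lambda>_. 0)}
      = boundary ?K (Suc (Suc i)) ` chains UNIV ?K (Suc (Suc i))" for i
  proof (intro equalityI subsetI)
    fix v assume "v \<in> {v \<in> chains UNIV ?K (Suc i). boundary ?K (Suc i) v = (\<lambda>_. 0)}"
    then have "boundary koszul (Suc (Suc i)) (koszul_cone (Suc i) v) = v"
      by (intro koszul_contract) auto
    then show "v \<in> boundary ?K (Suc (Suc i)) ` chains UNIV ?K (Suc (Suc i))"
      using koszul_cone_mem_chains by (metis image_eqI)
  qed (auto simp: boundary_mem_chains boundary_boundary_koszul)
qed

lemma resolves_field_koszul: "resolves_field koszul"
  using resolution_koszul by (auto simp: resolves_field_iff)

text \<open>Exactness is transferred in both directions; \<open>koszul\<close> also witnesses that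
  the choice in \<open>field_resolution\<close> is made from a nonempty set.\<close>

lemma tor_nonzero_koszul:
  fixes I :: "('n::{finite,linorder}, 'k::field) mpoly set"
  assumes "is_ideal I"
  shows "tor_nonzero I i j \<longleftrightarrow>
    \<not> {v \<in> graded_chains I koszul i j. boundary koszul i v = (\<lambda>_. 0)}
      \<subseteq> boundary koszul (Suc i) ` graded_chains I koszul (Suc i) j"
proof -
  have "resolves_field (field_resolution :: ('n, 'k) mpoly free_complex)"
    unfolding field_resolution_def using resolves_field_koszul by (rule someI)
  then show ?thesis
    unfolding tor_nonzero_def tor_cycles_def tor_boundaries_def
    using exact_tensor_transfer[OF _ resolves_field_koszul assms]
      exact_tensor_transfer[OF resolves_field_koszul _ assms] by meson
qed

text \<open>The boundary of \<open>u\<close> times the face \<open>{..m}\<close> has coefficients in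
  \<open>I\<close>, but every preimage of it has the same coefficient of \<open>u\<close> at that
  face, and \<open>u\<close> is not in \<open>I\<close>.\<close>

lemma koszul_not_exact:
  fixes I :: "('n::{finite,linorder}, 'k::field) mpoly set"
  assumes I: "monomial_ideal I" and u: "monom u \<notin> I" "\<forall>x\<in>keys u. x \<le> m"
    and um: "\<And>x. x \<le> m \<Longrightarrow> monom (u + unit_expo x) \<in> I"
    and i: "card {..m} = Suc i" and j: "j = int (expo_deg u) + int (Suc i)"
  shows "\<not> {v \<in> graded_chains I koszul i j. boundary koszul i v = (\<lambda>_. 0)}
      \<subseteq> boundary koszul (Suc i) ` graded_chains I koszul (Suc i) j"
proof
  assume exact: "{v \<in> graded_chains I koszul i j. boundary koszul i v = (\<lambda>_. 0)}
      \<subseteq> boundary koszul (Suc i) ` graded_chains I koszul (Suc i) j"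
  define w :: "nat \<Rightarrow> ('n, 'k) mpoly" where "w = (\<lambda>k. if k = face_index {..m} then monom u else 0)"
  interpret resolution "koszul :: ('n, 'k) mpoly free_complex" "\<lambda>_. 1" by (rule resolution_koszul)
  have m_less: "face_index {..m} < num_faces TYPE('n) (Suc i)"
    using face_index_less[of "{..m}"] i by simp
  have w: "w \<in> graded_chains UNIV koszul (Suc i) j"
    using m_less by (intro graded_chainsI) (auto simp: w_def j monom_def homogeneous_single)
  have "boundary koszul (Suc i) w \<in> graded_chains I koszul i j"
  proof (rule graded_chainsI)
    fix k assume "k < rank (koszul :: ('n, 'k) mpoly free_complex) i"
    then have k: "k < num_faces TYPE('n) i" by simp
    show "homogeneous (j - twist koszul i k) (boundary koszul (Suc i) w k)"
      using graded_chainsD(3)[OF boundary_mem_graded[OF is_ideal_UNIV w]] k by simp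
    define F where "F = (face i k :: 'n set)"
    have F: "card F = i" "k = face_index F" using k by (simp_all add: F_def face_index_face)
    have "monom t \<in> I" if "t \<in> keys (boundary koszul (Suc i) w k)" for t
    proof -
      have "(\<Sum>x\<in>keys t - F. face_sign x F * lookup (w (face_index (insert x F))) (t - unit_expo x)) \<noteq> 0"
        using that by (simp add: in_keys_iff F(2) lookup_boundary_koszul[OF F(1)])
      then obtain x where x: "x \<in> keys t - F"
        "face_sign x F * lookup (w (face_index (insert x F))) (t - unit_expo x) \<noteq> 0"
        by (rule sum.not_neutral_contains_not_neutral)
      then have idx: "face_index (insert x F) = face_index {..m}" and "t - unit_expo x = u"
        by (auto simp: w_def monom_def lookup_single when_def split: if_splits)
      then have "t = u + unit_expo x"
        using unit_expo_cancel[of x t] x(1) by simp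
      moreover have "card (insert x F) = card {..m}" using i x(1) F(1) by simp
      then have "insert x F = {..m}" using idx by (metis face_face_index)
      then have "x \<le> m" by blast
      ultimately show ?thesis using um by blast
    qed
    then show "boundary koszul (Suc i) w k \<in> I" using mem_monomial_ideal_iff[OF I] by blast
  qed (simp add: boundary_beyond_rank)
  then have "boundary koszul (Suc i) w \<in> boundary koszul (Suc i) ` graded_chains I koszul (Suc i) j"
    by (intro subsetD[OF exact]) (simp add: boundary_boundary_koszul)
  then obtain w' where w': "w' \<in> graded_chains I koszul (Suc i) j"
    and eq: "boundary koszul (Suc i) w' = boundary koszul (Suc i) w"
    by force
  have F: "card {..<m} = i" "insert m {..<m} = {..m}"
  proof -
    show "insert m {..<m} = {..m}" by auto
    then show "card {..<m} = i" using i by (metis card_insert_disjoint diff_Suc_1 finite lessThan_iff less_irrefl)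
  qed
  \<comment> \<open>At the face \<open>{..<m}\<close> the only variable of \<open>u x_m\<close> left
    to insert is \<open>x_m\<close>, so this coefficient of a boundary determines that of
    \<open>u\<close> at \<open>{..m}\<close>.\<close>
  have "keys (u + unit_expo m) - {..<m} = {m}"
    using u(2) by (auto simp: keys_add_expo)
  then have coeff: "lookup (boundary koszul (Suc i) z (face_index {..<m})) (u + unit_expo m)
      = face_sign m {..<m} * lookup (z (face_index {..m})) u" for z :: "nat \<Rightarrow> ('n, 'k) mpoly"
    by (simp add: lookup_boundary_koszul[OF F(1)] F(2))
  have "lookup (w' (face_index {..m})) u = lookup (w (face_index {..m})) u"
    using coeff[of w'] coeff[of w] by (simp add: eq)
  then have "u \<in> keys (w' (face_index {..m}))"
    by (simp add: w_def monom_def in_keys_iff)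
  moreover have "w' (face_index {..m}) \<in> I"
    using m_less by (intro graded_chainsD(1)[OF w']) simp
  ultimately show False
    using u(1) mem_monomial_ideal_iff[OF I] by blast
qed


section \<open>Minimal generators\<close>

lemma monom_dvd_iff:
  "(monom s :: ('n, 'k::field) mpoly) dvd monom t \<longleftrightarrow> (\<exists>r. t = r + s)"
proof
  assume "(monom s :: ('n, 'k) mpoly) dvd monom t"
  then obtain p :: "('n, 'k) mpoly" where "monom t = monom s * p" by (rule dvdE)
  then have "t \<in> keys (monom s * p)" by (metis keys_monom singletonI)
  then show "\<exists>r. t = r + s" using keys_mult[of "monom s" p] by (auto simp: add.commute)
next
  assume "\<exists>r. t = r + s"
  then show "(monom s :: ('n, 'k) mpoly) dvd monom t"
    by (metis dvd_triv_right monom_times)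
qed

text \<open>Some subsequence is monotone, and a decreasing sequence of naturals is constant from its
  minimum on.\<close>

lemma nat_seq_incseq_subseq:
  fixes f :: "nat \<Rightarrow> nat"
  obtains r :: "nat \<Rightarrow> nat" where "strict_mono r" "incseq (\<lambda>n. f (r n))"
proof -
  obtain q :: "nat \<Rightarrow> nat" where q: "strict_mono q" "monoseq (\<lambda>n. f (q n))"
    using seq_monosub by blast
  show thesis
  proof (cases "incseq (\<lambda>n. f (q n))")
    case True
    then show thesis using q(1) that by blast
  next
    case False
    then have dec: "decseq (\<lambda>n. f (q n))" using q(2) by (auto simp: monoseq_iff)
    obtain N where N: "\<And>n. f (q N) \<le> f (q n)"
      using ex_has_least_nat[of "\<lambda>_. True" _ "\<lambda>n. f (q n)"] by blast
    have "f (q (n + N)) = f (q N)" for n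
      using N[of "n + N"] decseqD[OF dec, of N "n + N"] by simp
    then have "incseq (\<lambda>n. f (q (n + N)))" by (simp add: incseq_def)
    moreover have "strict_mono (\<lambda>n. q (n + N))" using q(1) by (simp add: strict_mono_def)
    ultimately show thesis using that by blast
  qed
qed

text \<open>Refining to a subsequence once per variable makes all exponents weakly increasing
  together; any two of its terms then divide one another in order.\<close>

lemma dickson:
  fixes f :: "nat \<Rightarrow> 'n::finite expo"
  obtains i j r where "i < j" "f j = r + f i"
proof -
  have "\<exists>q :: nat \<Rightarrow> nat. strict_mono q \<and> (\<forall>x\<in>A. incseq (\<lambda>n. lookup (f (q n)) x))" for A :: "'n set"
  proof (induction A rule: infinite_finite_induct)
    case empty
    show ?case by (intro exI[of _ id]) (simp add: strict_mono_def)
  next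
    case (insert x A)
    then obtain q :: "nat \<Rightarrow> nat" where q: "strict_mono q" "\<And>y. y \<in> A \<Longrightarrow> incseq (\<lambda>n. lookup (f (q n)) y)"
      by blast
    obtain p :: "nat \<Rightarrow> nat" where p: "strict_mono p" "incseq (\<lambda>n. lookup (f (q (p n))) x)"
      by (rule nat_seq_incseq_subseq)
    have "strict_mono (\<lambda>n. q (p n))" using p q by (simp add: strict_mono_def)
    moreover have "incseq (\<lambda>n. lookup (f (q (p n))) y)" if "y \<in> A" for y
      using q(2)[OF that] strict_mono_mono[OF p(1)] by (simp add: mono_def)
    ultimately show ?case using p(2) by (intro exI[of _ "\<lambda>n. q (p n)"]) blast
  qed simp
  then obtain q :: "nat \<Rightarrow> nat" where q: "strict_mono q" "\<And>x. incseq (\<lambda>n. lookup (f (q n)) x)"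
    by (metis UNIV_I)
  have "f (q 1) = (f (q 1) - f (q 0)) + f (q 0)"
    using incseqD[OF q(2), of 0 1] by (intro poly_mapping_eqI) (simp add: lookup_add lookup_minus)
  moreover have "q 0 < q 1" using q(1) by (simp add: strict_mono_def)
  ultimately show thesis using that by blast
qed

text \<open>Minimal generators do not divide each other, so Dickson's lemma applies. Finiteness
  gives meaning to the \<open>Max\<close> in \<open>gen_deg\<close>.\<close>

lemma finite_min_gens:
  fixes I :: "('n::finite, 'k::field) mpoly set"
  shows "finite (min_gens I)"
proof (rule ccontr)
  assume "infinite (min_gens I)"
  then obtain f :: "nat \<Rightarrow> 'n expo" where f: "inj f" "range f \<subseteq> min_gens I"
    using infinite_countable_subset by blast
  obtain i j r where ij: "i < j" "f j = r + f i" by (rule dickson)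
  have "f i \<in> min_gens I" "f j \<in> min_gens I" using f(2) by auto
  moreover have "(monom (f i) :: ('n, 'k) mpoly) dvd monom (f j)"
    using ij(2) by (auto simp: monom_dvd_iff)
  ultimately have "f i = f j" by (simp add: min_gens_def)
  then show False using f(1) ij(1) by (auto dest: injD)
qed

lemma min_gens_exists:
  fixes I :: "('n::finite, 'k::field) mpoly set"
  assumes "monom t \<in> I"
  shows "\<exists>g\<in>min_gens I. \<exists>r. t = r + g"
  using assms
proof (induction "expo_deg t" arbitrary: t rule: less_induct)
  case less
  show ?case
  proof (cases "t \<in> min_gens I")
    case True
    then show ?thesis by (intro bexI[of _ t] exI[of _ 0]) auto
  next
    case False
    then obtain s r where s: "monom s \<in> I" "t = r + s" "s \<noteq> t"
      using less.prems by (auto simp: min_gens_def monom_dvd_iff)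
    then have "expo_deg r \<noteq> 0" by auto
    moreover have "expo_deg t = expo_deg r + expo_deg s" by (simp add: s(2))
    ultimately have "expo_deg s < expo_deg t" by linarith
    then obtain g r' where "g \<in> min_gens I" "s = r' + g" using less.hyps s(1) by blast
    then show ?thesis using s(2) by (intro bexI[of _ g] exI[of _ "r + r'"]) (auto simp: add.assoc)
  qed
qed

lemma expo_deg_le_gen_deg: "g \<in> min_gens I \<Longrightarrow> expo_deg g \<le> gen_deg I"
  by (simp add: gen_deg_def finite_min_gens)

lemma monomial_ideal_nonzero:
  assumes "monomial_ideal I" "I \<noteq> {0}"
  obtains t where "monom t \<in> I"
proof -
  obtain p where "p \<in> I" "p \<noteq> 0"
    using assms is_idealD(1)[OF monomial_ideal_is_ideal[OF assms(1)]] by blast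
  then show thesis using that mem_monomial_ideal_iff[OF assms(1)] keys_eq_empty by blast
qed


section \<open>Stable truncations\<close>

definition colon_closed :: "('n::{finite,linorder}, 'k::field) mpoly set \<Rightarrow> nat \<Rightarrow> bool"
  where "colon_closed I e \<longleftrightarrow> (\<forall>u m. e \<le> expo_deg u \<longrightarrow> (\<forall>x\<in>keys u. x \<le> m)
    \<longrightarrow> monom (u + unit_expo m) \<in> I \<longrightarrow> monom u \<in> I)"

lemma colon_closedD:
  "colon_closed I e \<Longrightarrow> e \<le> expo_deg u \<Longrightarrow> (\<And>x. x \<in> keys u \<Longrightarrow> x \<le> m)
    \<Longrightarrow> monom (u + unit_expo m) \<in> I \<Longrightarrow> monom u \<in> I"
  unfolding colon_closed_def by blast

text \<open>The degree bound on \<open>t\<close> is strict because the condition is applied to the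
  quotient, whose degree is one less.\<close>

lemma colon_closed_remove_max:
  assumes "colon_closed I e" "monom t \<in> I" "e < expo_deg t"
  shows "monom (t - unit_expo (Max (keys t))) \<in> I"
    and "t - unit_expo (Max (keys t)) + unit_expo (Max (keys t)) = t"
    and "Suc (expo_deg (t - unit_expo (Max (keys t)))) = expo_deg t"
proof -
  let ?m = "Max (keys t)"
  have "t \<noteq> 0" using assms(3) by auto
  then show t: "t - unit_expo ?m + unit_expo ?m = t"
    by (intro unit_expo_cancel Max_in) auto
  show deg: "Suc (expo_deg (t - unit_expo ?m)) = expo_deg t"
    by (subst (2) t[symmetric], subst expo_deg_add) simp
  show "monom (t - unit_expo ?m) \<in> I"
  proof (rule colon_closedD[OF assms(1)])
    show "e \<le> expo_deg (t - unit_expo ?m)" using assms(3) deg by linarith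
    show "x \<le> ?m" if "x \<in> keys (t - unit_expo ?m)" for x
      using that by (intro Max_ge) (auto simp: in_keys_iff lookup_minus)
    show "monom (t - unit_expo ?m + unit_expo ?m) \<in> I" unfolding t by (rule assms(2))
  qed
qed

lemma truncation_eq: "truncation I e = ideal_gen (monom ` {t. monom t \<in> I \<and> e \<le> int (expo_deg t)})"
  unfolding truncation_def by (rule arg_cong[of _ _ ideal_gen]) auto

lemma monom_mem_truncation:
  assumes "monomial_ideal I"
  shows "monom t \<in> truncation I e \<longleftrightarrow> monom t \<in> I \<and> e \<le> int (expo_deg t)"
proof
  assume "monom t \<in> truncation I e"
  then obtain a s where a: "monom a \<in> I" "e \<le> int (expo_deg a)" "t = s + a"
    unfolding truncation_eq monom_mem_ideal_gen_monoms by blast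
  then show "monom t \<in> I \<and> e \<le> int (expo_deg t)"
    using monom_mem_add[OF monomial_ideal_is_ideal[OF assms] a(1), of s] by simp
next
  assume "monom t \<in> I \<and> e \<le> int (expo_deg t)"
  then show "monom t \<in> truncation I e"
    unfolding truncation_eq by (intro subsetD[OF ideal_gen_superset] imageI) simp
qed

text \<open>Both conditions exchange variables: \<open>u\<close> is obtained from
  \<open>u x_m\<close> by first dividing by some \<open>x_l\<close> without leaving \<open>I\<close>
  and then trading \<open>x_m\<close> for \<open>x_l\<close>; conversely \<open>x_i t / x_m\<close>
  times \<open>x_m\<close> is the element \<open>x_i t\<close> of \<open>I\<close>.\<close>

lemma stable_truncation_iff:
  fixes I :: "('n::{finite,linorder}, 'k::field) mpoly set"
  assumes I: "monomial_ideal I" "I \<noteq> {0}"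
  shows "gen_deg I \<le> e \<and> stable_ideal (truncation I (int e)) \<longleftrightarrow> colon_closed I e"
proof
  assume e: "gen_deg I \<le> e \<and> stable_ideal (truncation I (int e))"
  show "colon_closed I e"
    unfolding colon_closed_def
  proof (intro allI impI)
    fix u m
    assume u: "e \<le> expo_deg u" "\<forall>x\<in>keys u. x \<le> m" "monom (u + unit_expo m) \<in> I"
    obtain g r where g: "g \<in> min_gens I" "u + unit_expo m = r + g"
      using min_gens_exists[OF u(3)] by blast
    have "expo_deg u + 1 = expo_deg r + expo_deg g"
      using arg_cong[OF g(2), of expo_deg] by simp
    \<comment> \<open>Here \<open>gen_deg I \<le> e\<close> enters: \<open>g\<close> has degree at
      most \<open>e\<close>, so it divides \<open>u x_m\<close> properly.\<close>
    then have "expo_deg r \<noteq> 0"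
      using expo_deg_le_gen_deg[OF g(1)] e u(1) by linarith
    then have "keys r \<noteq> {}" by simp
    then obtain l where l: "l \<in> keys r" by blast
    define v where "v = (r - unit_expo l) + g"
    have lv: "unit_expo l + v = u + unit_expo m"
      using unit_expo_cancel[OF l] g(2) by (simp add: v_def add_ac)
    have "monom g \<in> I" using g(1) by (simp add: min_gens_def)
    then have v: "monom v \<in> I"
      unfolding v_def by (rule monom_mem_add[OF monomial_ideal_is_ideal[OF I(1)]])
    show "monom u \<in> I"
    proof (cases "l = m")
      case True
      then show ?thesis using lv v by (simp add: add.commute)
    next
      case False
      have keys: "insert l (keys v) = insert m (keys u)"
        using arg_cong[OF lv, of keys] by (auto simp: keys_add_expo)
      have "m \<in> insert l (keys v)" unfolding keys by simp
      then have m: "m \<in> keys v" using False by simp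
      moreover have "x \<le> m" if "x \<in> keys v" for x
        using insertI2[OF that, of l] u(2) unfolding keys by auto
      ultimately have max: "Max (keys v) = m" by (intro Max_eqI) auto
      have "l \<in> insert m (keys u)" unfolding keys[symmetric] by simp
      then have "l < m" using False u(2) by auto
      moreover have "v \<noteq> 0" using m by auto
      moreover have "expo_deg v = expo_deg u" using arg_cong[OF lv, of expo_deg] by simp
      then have "monom v \<in> truncation I (int e)"
        using v u(1) by (simp add: monom_mem_truncation[OF I(1)])
      \<comment> \<open>As \<open>m\<close> is the largest variable of
        \<open>v = u x_m / x_l\<close>, stability replaces it by \<open>x_l\<close>, which gives
        \<open>u\<close>.\<close>
      ultimately have "monom (unit_expo l + v - unit_expo m) \<in> truncation I (int e)"
        using e unfolding stable_ideal_def max[symmetric] by blast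
      then show ?thesis by (simp add: lv monom_mem_truncation[OF I(1)])
    qed
  qed
next
  assume cl: "colon_closed I e"
  \<comment> \<open>A generator of degree above \<open>e\<close> could be divided by its largest
    variable inside \<open>I\<close>, against minimality.\<close>
  have "expo_deg g \<le> e" if g: "g \<in> min_gens I" for g
  proof (rule ccontr)
    assume "\<not> expo_deg g \<le> e"
    then have deg: "e < expo_deg g" by simp
    have "monom g \<in> I" using g by (simp add: min_gens_def)
    note rem = colon_closed_remove_max[OF cl this deg]
    have "(monom (g - unit_expo (Max (keys g))) :: ('n, 'k) mpoly) dvd monom g"
      using rem(2) by (metis monom_dvd_iff add.commute)
    then have "g - unit_expo (Max (keys g)) = g" using g rem(1) by (simp add: min_gens_def)
    then show False using rem(3) by simp
  qed
  moreover obtain t where "monom t \<in> I" using monomial_ideal_nonzero[OF I] .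
  then have "min_gens I \<noteq> {}" using min_gens_exists by blast
  ultimately have "gen_deg I \<le> e" by (simp add: gen_deg_def finite_min_gens)
  moreover have "stable_ideal (truncation I (int e))"
    unfolding stable_ideal_def
  proof (intro conjI allI impI)
    show "monomial_ideal (truncation I (int e))"
      unfolding monomial_ideal_def truncation_eq by blast
    fix t i assume t: "(monom t :: ('n, 'k) mpoly) \<in> truncation I (int e)" "t \<noteq> 0" "i < Max (keys t)"
    let ?m = "Max (keys t)"
    have "?m \<in> keys t" using t(2) by (intro Max_in) auto
    then have c: "t - unit_expo ?m + unit_expo ?m = t" by (rule unit_expo_cancel)
    define w where "w = unit_expo i + (t - unit_expo ?m)"
    have w: "w + unit_expo ?m = unit_expo i + t" by (simp add: w_def add.assoc c)
    have w': "unit_expo i + t - unit_expo ?m = w" by (simp flip: w)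
    have "monom t \<in> I" "e \<le> expo_deg t" using t(1) by (auto simp: monom_mem_truncation[OF I(1)])
    moreover have "expo_deg w = expo_deg t" using arg_cong[OF w, of expo_deg] by simp
    moreover have "x \<le> ?m" if "x \<in> keys w" for x
    proof -
      have "x = i \<or> x \<in> keys t" using that by (auto simp: w_def keys_add_expo in_keys_iff lookup_minus lookup_single)
      then show ?thesis using t(3) by auto
    qed
    ultimately have "monom w \<in> I"
      using monom_mem_add[OF monomial_ideal_is_ideal[OF I(1)], of t "unit_expo i"]
      by (intro colon_closedD[OF cl, of w ?m]) (auto simp: w)
    then show "monom (unit_expo i + t - unit_expo ?m) \<in> truncation I (int e)"
      unfolding w' using \<open>e \<le> expo_deg t\<close> \<open>expo_deg w = expo_deg t\<close>
      by (simp add: monom_mem_truncation[OF I(1)])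
  qed
  ultimately show "gen_deg I \<le> e \<and> stable_ideal (truncation I (int e))" by blast
qed


section \<open>Ideals of Borel type\<close>

text \<open>The exponent 1 suffices: the multipliers that send \<open>u\<close> into
  \<open>I\<close> form an ideal containing \<open>x_m\<close>.\<close>

lemma monom_mem_saturation_var:
  fixes I :: "('n, 'k::field) mpoly set"
  assumes I: "is_ideal I" and u: "monom (u + unit_expo m) \<in> I"
  shows "monom u \<in> saturation I (ideal_gen {var m})"
proof -
  have ideal: "is_ideal {g. monom u * g \<in> I}"
    using I unfolding is_ideal_iff by (simp add: distrib_left mult.left_commute)
  have "ideal_gen {var m} \<subseteq> {g. monom u * g \<in> I}"
    using u by (intro ideal_gen_minimal ideal) (simp add: var_def monom_times)
  then have "{a * b |a b. a \<in> ideal_gen {var m} \<and> b \<in> UNIV} \<subseteq> {g. monom u * g \<in> I}"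
    using is_idealD(3)[OF ideal] by (auto simp: mult.commute)
  then have "ideal_power (ideal_gen {var m}) 1 \<subseteq> {g. monom u * g \<in> I}"
    using ideal_gen_minimal[OF _ ideal] by (simp add: One_nat_def)
  then show ?thesis unfolding saturation_def colon_def by (intro UN_I[of 1]) auto
qed

lemma power_mem_ideal_power: "a \<in> J \<Longrightarrow> a ^ k \<in> ideal_power J k"
  using ideal_gen_superset by (induction k) force+

lemma var_power: "var x ^ k = (monom (Poly_Mapping.single x k) :: ('n, 'k::field) mpoly)"
proof (induction k)
  case (Suc k)
  have "unit_expo x + Poly_Mapping.single x k = Poly_Mapping.single x (Suc k)"
    by (simp add: One_nat_def flip: single_add)
  then show ?case using Suc by (simp add: var_def monom_times)
qed (simp add: monom_def)

lemma monom_add_mem_of_saturation: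
  assumes "monom u \<in> saturation I J" "var x \<in> J"
  obtains k where "monom (u + Poly_Mapping.single x k) \<in> I"
proof -
  obtain k where "\<forall>g \<in> ideal_power J k. monom u * g \<in> I"
    using assms(1) by (auto simp: saturation_def colon_def)
  then have "monom u * var x ^ k \<in> I" using power_mem_ideal_power[OF assms(2)] by blast
  then show thesis using that by (simp add: var_power monom_times)
qed

lemma borel_type_colon_closed:
  fixes I :: "('n::{finite,linorder}, 'k::field) mpoly set"
  assumes "borel_type I"
  shows "\<exists>e. colon_closed I e"
proof -
  let ?D = "gen_deg I"
  have I: "is_ideal I" using assms monomial_ideal_is_ideal by (auto simp: borel_type_def)
  have "monom u \<in> I" if deg: "CARD('n) * ?D < expo_deg u" and max: "\<forall>x\<in>keys u. x \<le> m"
    and um: "monom (u + unit_expo m) \<in> I" for u m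
  proof -
    \<comment> \<open>Pigeonhole: the exponents of \<open>u\<close> sum to more than
      \<open>n\<close> times \<open>deg I\<close>.\<close>
    obtain x where x: "?D < lookup u x"
    proof (rule ccontr)
      assume "\<not> thesis"
      then have "lookup u x \<le> ?D" for x using that not_le by blast
      then have "expo_deg u \<le> CARD('n) * ?D"
        unfolding expo_deg_def using sum_bounded_above[of UNIV "lookup u" ?D] by simp
      then show False using deg by simp
    qed
    then have "x \<le> m" using max by (simp add: in_keys_iff)
    \<comment> \<open>Borel type trades \<open>x_m\<close> for all variables up to
      \<open>x_m\<close>, in particular for the \<open>x\<close> with large exponent.\<close>
    have "monom u \<in> saturation I (ideal_gen (var ` {..m}))"
      using monom_mem_saturation_var[OF I um] assms by (simp add: borel_type_def)
    moreover have "var x \<in> ideal_gen (var ` {..m} :: ('n, 'k) mpoly set)"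
      using \<open>x \<le> m\<close> by (intro subsetD[OF ideal_gen_superset] imageI) simp
    ultimately obtain k where "monom (u + Poly_Mapping.single x k) \<in> I"
      by (rule monom_add_mem_of_saturation)
    then obtain g r where g: "g \<in> min_gens I" "u + Poly_Mapping.single x k = r + g"
      using min_gens_exists by blast
    \<comment> \<open>The power of \<open>x\<close> is harmless: there \<open>g\<close> has exponent
      at most \<open>deg I\<close>, which \<open>u\<close> already exceeds. Hence \<open>g\<close>
      divides \<open>u\<close> itself.\<close>
    have "lookup g y \<le> lookup u y" for y
    proof (cases "y = x")
      case True
      have "lookup g x \<le> expo_deg g" unfolding expo_deg_def by (rule member_le_sum) auto
      then show ?thesis using True x expo_deg_le_gen_deg[OF g(1)] by simp
    next
      case False
      then show ?thesis
        using arg_cong[OF g(2), of "\<lambda>t. lookup t y"] by (simp add: lookup_add lookup_single)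
    qed
    then have "u = (u - g) + g" by (intro poly_mapping_eqI) (simp add: lookup_add lookup_minus)
    moreover have "monom g \<in> I" using g(1) by (simp add: min_gens_def)
    ultimately show ?thesis using monom_mem_add[OF I] by metis
  qed
  then have "colon_closed I (Suc (CARD('n) * ?D))" by (simp add: colon_closed_def Suc_le_eq)
  then show ?thesis by blast
qed


section \<open>Regularity\<close>

text \<open>If \<open>j - i > e\<close>, the cone only meets monomials of degree
  \<open>j - i - 1 \<ge> e\<close>, where the colon condition is available.\<close>

lemma tor_nonzero_le:
  fixes I :: "('n::{finite,linorder}, 'k::field) mpoly set"
  assumes "monomial_ideal I" "colon_closed I e" "tor_nonzero I i j"
  shows "j - int i \<le> int e"
proof (rule ccontr)
  assume "\<not> j - int i \<le> int e"
  then have "{v \<in> graded_chains I koszul i j. boundary koszul i v = (\<lambda>_. 0)}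
      \<subseteq> boundary koszul (Suc i) ` graded_chains I koszul (Suc i) j"
    using assms by (intro koszul_exact) (auto intro: colon_closedD)
  then show False
    using assms by (simp add: tor_nonzero_koszul monomial_ideal_is_ideal)
qed

text \<open>Serves the case \<open>e = 0\<close>, where no monomial of degree \<open>e - 1\<close>
  exists: the class of 1 is no boundary, as boundaries have no constant term.\<close>

lemma tor_nonzero_unit_ideal:
  fixes I :: "('n::{finite,linorder}, 'k::field) mpoly set"
  assumes I: "is_ideal I" "monom 0 \<in> I"
  shows "tor_nonzero I 0 0"
proof -
  define z :: "nat \<Rightarrow> ('n, 'k) mpoly" where "z = (\<lambda>k. if k = 0 then monom 0 else 0)"
  have "z \<in> graded_chains I koszul 0 0"
    using I by (intro graded_chainsI) (auto simp: z_def monom_def num_faces_0 homogeneous_def)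
  moreover have "z \<noteq> boundary koszul (Suc 0) w" for w
  proof
    assume "z = boundary koszul (Suc 0) w"
    then have "lookup (z 0) 0 = 0"
      using lookup_boundary_koszul[of "{} :: 'n set" 0 w 0] by (simp add: face_index_empty)
    then show False by (simp add: z_def monom_def)
  qed
  ultimately show ?thesis
    unfolding tor_nonzero_koszul[OF I(1)] by auto
qed

lemma tor_nonzero_least:
  fixes I :: "('n::{finite,linorder}, 'k::field) mpoly set"
  assumes I: "monomial_ideal I" "I \<noteq> {0}"
    and e: "colon_closed I e" and least: "\<And>e'. e' < e \<Longrightarrow> \<not> colon_closed I e'"
  shows "\<exists>i j. tor_nonzero I i j \<and> int e = j - int i"
proof (cases e)
  case 0
  \<comment> \<open>For \<open>e = 0\<close> the largest variable can be removed again and again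
    until 1 is reached.\<close>
  have "monom 0 \<in> I" if "monom t \<in> I" for t
    using that
  proof (induction "expo_deg t" arbitrary: t)
    case (Suc d)
    then show ?case using colon_closed_remove_max[OF e, of t] 0 by (metis Suc_inject zero_less_Suc)
  qed simp
  then have "monom 0 \<in> I" using monomial_ideal_nonzero[OF I] by blast
  then have "tor_nonzero I 0 0"
    by (rule tor_nonzero_unit_ideal[OF monomial_ideal_is_ideal[OF I(1)]])
  then show ?thesis using 0 by (intro exI[of _ 0]) simp
next
  case (Suc d)
  then obtain u m where u: "d \<le> expo_deg u" "\<forall>x\<in>keys u. x \<le> m" "monom (u + unit_expo m) \<in> I" "monom u \<notin> I"
    using least[of d] by (auto simp: colon_closed_def)
  \<comment> \<open>The condition fails from \<open>d = e - 1\<close> on but holds from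
    \<open>e\<close> on, so the failure sits exactly in degree \<open>d\<close>.\<close>
  then have deg: "expo_deg u = d"
    using colon_closedD[OF e, of u m] Suc by force
  \<comment> \<open>\<open>u x\<close> has degree \<open>e\<close> and \<open>u x x_m\<close> lies
    in \<open>I\<close>, so the condition at \<open>e\<close> applies to \<open>u x\<close>.\<close>
  have um: "monom (u + unit_expo x) \<in> I" if "x \<le> m" for x
  proof (rule colon_closedD[OF e, of _ m])
    show "e \<le> expo_deg (u + unit_expo x)" using Suc deg by simp
    show "y \<le> m" if "y \<in> keys (u + unit_expo x)" for y
      using that u(2) \<open>x \<le> m\<close> by (auto simp: keys_add_expo)
    show "monom (u + unit_expo x + unit_expo m) \<in> I"
      using monom_mem_add[OF monomial_ideal_is_ideal[OF I(1)] u(3), of "unit_expo x"] by (simp add: add_ac)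
  qed
  have "card {..m} \<noteq> 0" by auto
  then obtain i where i: "card {..m} = Suc i" using not0_implies_Suc by blast
  have "tor_nonzero I i (int (expo_deg u) + int (Suc i))"
    unfolding tor_nonzero_koszul[OF monomial_ideal_is_ideal[OF I(1)]]
    using u um i by (intro koszul_not_exact[OF I(1)]) auto
  then show ?thesis using Suc deg by force
qed

theorem corollary1p7:
  fixes I :: "('n::{finite,linorder}, 'k::field) mpoly set"
  assumes "infinite (UNIV :: 'k set)"
    and "2 \<le> CARD('n)"
    and "borel_type I"
    and "I \<noteq> {0}"
  shows "regularity I \<in> {e. int (gen_deg I) \<le> e \<and> stable_ideal (truncation I e)} \<and>
    (\<forall>e \<in> {e. int (gen_deg I) \<le> e \<and> stable_ideal (truncation I e)}. regularity I \<le> e)"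
proof -
  have I: "monomial_ideal I" "I \<noteq> {0}" using assms by (auto simp: borel_type_def)
  define e where "e = (LEAST e. colon_closed I e)"
  have e: "colon_closed I e"
    unfolding e_def using borel_type_colon_closed[OF assms(3)] by (rule LeastI_ex)
  have least: "e \<le> e'" if "colon_closed I e'" for e'
    unfolding e_def using that by (rule Least_le)
  have "\<exists>i j. tor_nonzero I i j \<and> int e = j - int i"
    using least by (intro tor_nonzero_least[OF I e]) (use not_le in blast)
  \<comment> \<open>The \<open>GREATEST\<close> needs both halves: the value \<open>e\<close> is
    attained and bounds all others.\<close>
  then have reg: "regularity I = int e"
    unfolding regularity_def using tor_nonzero_le[OF I(1) e] by (intro Greatest_equality) auto
  show ?thesis
  proof (intro conjI ballI)
    show "regularity I \<in> {e. int (gen_deg I) \<le> e \<and> stable_ideal (truncation I e)}"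
      using stable_truncation_iff[OF I, of e] e by (simp add: reg)
  next
    fix d assume "d \<in> {e. int (gen_deg I) \<le> e \<and> stable_ideal (truncation I e)}"
    then have d: "int (gen_deg I) \<le> d" "stable_ideal (truncation I d)" by auto
    \<comment> \<open>The lower bound by \<open>gen_deg I\<close> makes the integer \<open>d\<close>
      nonnegative, so the criterion for naturals applies.\<close>
    then have "d = int (nat d)" by simp
    then have "colon_closed I (nat d)"
      using stable_truncation_iff[OF I, of "nat d"] d by (metis of_nat_le_iff)
    then have "e \<le> nat d" by (rule least)
    then show "regularity I \<le> d" using \<open>d = int (nat d)\<close> unfolding reg by linarith
  qed
qed

end
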